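(* Let $f\in F$ with $\#f=k$. Then in $\mathbb{Z}F$ $$(1+\sigma_1)(1+\sigma_2)\cdots(1+\sigma_k)f=\sum_{g\in P(f)}g .$$
   Context: $F$ is the set of all functions $f:\mathbb{Z}\to\{\times,\circ,<,>\}$ with $f(a)=\circ$ for all but finitely many $a$; $\mathbb{Z}F$ is the free abelian group with basis $F$. Put $\#f=|f^{-1}(\times)|$, $core_L(f)=f^{-1}(>)$, $core_R(f)=f^{-1}(<)$, $core(f)=(core_L(f),core_R(f))$. The weight diagram $D_{wt}(f)$ is the number line with the symbol $f(a)$ at each integer $a$. If $\#f=k$ write $\times(f)=(a_1,\dots,a_k)$ where $f^{-1}(\times)=\{a_1>a_2>\dots>a_k\}$. Cap diagrams. Let $C_L,C_R\subset\mathbb{Z}$ be disjoint finite sets. A cap joins two integers $b<a$ not in $C_L\cup C_R$ by the upper half of a circle; it begins at $b$ and ends at $a$. A cap diagram with core $(C_L,C_R)$ is a finite set of caps, no two of which intersect (in particular they have no common endpoints), such that every integer lying strictly under a cap is either an endpoint of another cap or an element of $C_L\cup C_R$. For $f\in F$, $D_{cap}(f)$ is the unique cap diagram with core $core(f)$ whose caps begin exactly at the elements of $f^{-1}(\times)$. Matching. $D_{cap}(g)$ matches $D_{wt}(f)$ if $core(g)=core(f)$, $\#g=\#f$, and each cap of $D_{cap}(g)$ joins two integers of which one is labelled $\times$ and the other $\circ$ by $f$. $P(f)=\{g\in F : D_{cap}(g)\text{ matches }D_{wt}(f)\}$. Legal moves. If $f(a)=\times$ and $f(b)=\circ$, then $f^a_b\in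 F$ is the function with the same core as $f$ and $(f^a_b)^{-1}(\times)=(f^{-1}(\times)\setminus\{a\})\cup\{b\}$. For $b<a$, $l_f(b,a)$ is the number of symbols $\times$ minus the number of symbols $\circ$ of $f$ at integers strictly between $b$ and $a$. $f^a_b$ is obtained from $f$ by a legal move (with start $a$, end $b$, weight $l_f(b,a)$) if $b<a$, $f(a)=\times$, $f(b)=\circ$ and $l_f(b,c)\ge 0$ for all integers $c$ with $b<c\le a$. Operators. For $1\le i\le k$, $\sigma_i$ is the $\mathbb{Z}$-linear operator on the span of the $f\in F$ with $\#f=k$ given, for $\times(f)=(a_1,\dots,a_k)$ and $a=a_i$, by $\sigma_i(f)=\sum_b(-1)^{l_f(b,a)}f^a_b$, the sum being over all $b$ such that $f^a_b$ is obtained from $f$ by a legal move. Products of operators are compositions, with $1+\sigma_k$ applied first. *)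

theory Defs
  imports Complex_Main "HOL-Library.Poly_Mapping"
begin

datatype symbol = Cross | Circ | Less | Greater

definition weights :: "(int \<Rightarrow> symbol) set"
  where "weights = {f. finite {a. f a \<noteq> Circ}}"

definition crosses :: "(int \<Rightarrow> symbol) \<Rightarrow> int set"
  where "crosses f = {a. f a = Cross}"

definition num_crosses :: "(int \<Rightarrow> symbol) \<Rightarrow> nat"
  where "num_crosses f = card (crosses f)"

definition core_L :: "(int \<Rightarrow> symbol) \<Rightarrow> int set"
  where "core_L f = {a. f a = Greater}"

definition core_R :: "(int \<Rightarrow> symbol) \<Rightarrow> int set"
  where "core_R f = {a. f a = Less}"

definition core :: "(int \<Rightarrow> symbol) \<Rightarrow> int set \<times> int set"
  where "core f = (core_L f, core_R f)"

definition cross_list :: "(int \<Rightarrow> symbol) \<Rightarrow> int list"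
  where "cross_list f = rev (sorted_list_of_set (crosses f))"

text \<open>A cap joining \<open>b < a\<close> is represented by the pair \<open>(b, a)\<close>; as a subset of the plane it is
  the closed upper half of the circle with diameter from \<open>(b, 0)\<close> to \<open>(a, 0)\<close>.\<close>

type_synonym cap = "int \<times> int"

definition cap_arc :: "cap \<Rightarrow> (real \<times> real) set"
  where "cap_arc c = (case c of (b, a) \<Rightarrow>
    {(x, y). 0 \<le> y \<and>
       (x - (real_of_int a + real_of_int b) / 2)\<^sup>2 + y\<^sup>2 = ((real_of_int a - real_of_int b) / 2)\<^sup>2})"

definition cap_ends :: "cap set \<Rightarrow> int set"
  where "cap_ends D = fst ` D \<union> snd ` D"

definition cap_diagram :: "int set \<Rightarrow> int set \<Rightarrow> cap set \<Rightarrow> bool"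
  where "cap_diagram CL CR D \<longleftrightarrow>
     finite D \<and>
     (\<forall>(b, a)\<in>D. b < a \<and> b \<notin> CL \<union> CR \<and> a \<notin> CL \<union> CR) \<and>
     (\<forall>c\<in>D. \<forall>d\<in>D. c \<noteq> d \<longrightarrow> cap_arc c \<inter> cap_arc d = {}) \<and>
     (\<forall>(b, a)\<in>D. \<forall>n. b < n \<and> n < a \<longrightarrow> n \<in> cap_ends (D - {(b, a)}) \<union> (CL \<union> CR))"

definition D_cap :: "(int \<Rightarrow> symbol) \<Rightarrow> cap set"
  where "D_cap f = (THE D. cap_diagram (core_L f) (core_R f) D \<and> fst ` D = crosses f)"

definition matches :: "(int \<Rightarrow> symbol) \<Rightarrow> (int \<Rightarrow> symbol) \<Rightarrow> bool"
  where "matches g f \<longleftrightarrow>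
     core g = core f \<and> num_crosses g = num_crosses f \<and>
     (\<forall>(b, a)\<in>D_cap g. (f b = Cross \<and> f a = Circ) \<or> (f b = Circ \<and> f a = Cross))"

definition P_set :: "(int \<Rightarrow> symbol) \<Rightarrow> (int \<Rightarrow> symbol) set"
  where "P_set f = {g \<in> weights. matches g f}"

definition move :: "(int \<Rightarrow> symbol) \<Rightarrow> int \<Rightarrow> int \<Rightarrow> (int \<Rightarrow> symbol)"
  where "move f a b = f(a := Circ, b := Cross)"

definition move_weight :: "(int \<Rightarrow> symbol) \<Rightarrow> int \<Rightarrow> int \<Rightarrow> int"
  where "move_weight f b a =
     int (card {n. b < n \<and> n < a \<and> f n = Cross}) - int (card {n. b < n \<and> n < a \<and> f n = Circ})"

definition legal_move :: "(int \<Rightarrow> symbol) \<Rightarrow> int \<Rightarrow> int \<Rightarrow> bool"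
  where "legal_move f a b \<longleftrightarrow>
     b < a \<and> f a = Cross \<and> f b = Circ \<and> (\<forall>c. b < c \<and> c \<le> a \<longrightarrow> 0 \<le> move_weight f b c)"

text \<open>The free abelian group on \<^const>\<open>weights\<close> is the subgroup of the finitely supported functions
  \<open>(int \<Rightarrow> symbol) \<Rightarrow>\<^sub>0 int\<close> that vanish off \<^const>\<open>weights\<close>. The weight of a legal move is
  nonnegative, so taking \<^const>\<open>nat\<close> of it in the exponent loses nothing. The value of
  \<open>sigma i\<close> at a basis element with fewer than \<open>i\<close> crosses, or at one outside
  \<^const>\<open>weights\<close>, has no meaning.\<close>

definition sigma :: "nat \<Rightarrow> ((int \<Rightarrow> symbol) \<Rightarrow>\<^sub>0 int) \<Rightarrow> ((int \<Rightarrow> symbol) \<Rightarrow>\<^sub>0 int)"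
  where "sigma i = frag_extend (\<lambda>f. let a = cross_list f ! (i - 1) in
     \<Sum>b | legal_move f a b. frag_cmul ((- 1) ^ nat (move_weight f b a)) (frag_of (move f a b)))"

lemma core_move:
  assumes "f a = Cross" "f b = Circ"
  shows "core (move f a b) = core f" "crosses (move f a b) = (crosses f - {a}) \<union> {b}"
  using assms by (auto simp: core_def core_L_def core_R_def crosses_def move_def)

lemma move_in_weights: "f \<in> weights \<Longrightarrow> move f a b \<in> weights"
proof -
  assume "f \<in> weights"
  moreover have "{n. move f a b n \<noteq> Circ} \<subseteq> insert b {n. f n \<noteq> Circ}"
    by (auto simp: move_def)
  ultimately show ?thesis
    unfolding weights_def by (simp add: finite_subset)
qed

lemma finite_crosses: "f \<in> weights \<Longrightarrow> finite (crosses f)"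
  unfolding weights_def crosses_def by (auto elim: rev_finite_subset)

lemma finite_core: "f \<in> weights \<Longrightarrow> finite (core_L f \<union> core_R f)"
  unfolding weights_def core_L_def core_R_def
  by (auto elim: rev_finite_subset)

lemma finite_legal_move:
  assumes "f \<in> weights"
  shows "finite {b. legal_move f a b}"
proof -
  let ?S = "{n. f n \<noteq> Circ}"
  have fin: "finite ?S" using assms by (simp add: weights_def)
  have "a - 1 - 2 * int (card ?S) \<le> b" if "legal_move f a b" for b
  proof -
    let ?X = "{n. b < n \<and> n < a \<and> f n = Cross}" and ?O = "{n. b < n \<and> n < a \<and> f n = Circ}"
    have ba: "b < a" and l: "0 \<le> move_weight f b a" using that by (auto simp: legal_move_def)
    have sub: "?X \<subseteq> ?S" by auto
    have fO: "finite ?O" by (rule finite_subset[of _ "{b<..<a}"]) auto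
    have 1: "card ?X \<le> card ?S" using fin sub by (rule card_mono)
    have 2: "card ?O \<le> card ?X" using l by (simp add: move_weight_def)
    have "card {b<..<a} \<le> card (?O \<union> ?S)"
      by (rule card_mono) (use fO fin in auto)
    also have "\<dots> \<le> card ?O + card ?S" by (rule card_Un_le)
    finally show ?thesis using 1 2 ba by simp
  qed
  then have "{b. legal_move f a b} \<subseteq> {a - 1 - 2 * int (card ?S)..a}"
    by (auto simp: legal_move_def)
  then show ?thesis by (rule finite_subset) simp
qed

lemma cap_arc_iff: "(x, y) \<in> cap_arc (b, a) \<longleftrightarrow> 0 \<le> y \<and> y\<^sup>2 = (x - of_int b) * (of_int a - x)"
  unfolding cap_arc_def by (auto simp: field_simps power2_eq_square)

lemma cap_arc_range:
  assumes "(x, y) \<in> cap_arc (b, a)" "b < a"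
  shows "of_int b \<le> x" "x \<le> of_int a"
proof -
  have "0 \<le> (x - of_int b) * (of_int a - x)"
    using assms(1) by (metis cap_arc_iff zero_le_power2)
  with assms(2) show "of_int b \<le> x" "x \<le> of_int a"
    by (auto simp: zero_le_mult_iff)
qed

lemma cap_arcs_nested:
  assumes "b < d" "d < c" "c < a"
  shows "cap_arc (b, a) \<inter> cap_arc (d, c) = {}"
proof -
  have False if 1: "(x, y) \<in> cap_arc (b, a)" and 2: "(x, y) \<in> cap_arc (d, c)" for x y
  proof -
    have r: "real_of_int d \<le> x" "x \<le> real_of_int c" using cap_arc_range[OF 2] assms by auto
    have e: "(x - b) * (a - x) = (x - d) * (c - x)" using 1 2 by (simp add: cap_arc_iff)
    have s: "real_of_int b < d" "real_of_int c < a" using assms by auto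
    have "(x - d) * (c - x) \<le> (x - d) * (a - x)"
      using r s by (intro mult_left_mono) auto
    also have "\<dots> < (x - b) * (a - x)"
      using r s by (intro mult_strict_right_mono) auto
    finally show False using e by simp
  qed
  then show ?thesis by auto
qed

lemma cap_arcs_crossing:
  assumes "b < d" "d < a" "a < c"
  shows "cap_arc (b, a) \<inter> cap_arc (d, c) \<noteq> {}"
proof -
  define A B C D where ABCD: "A = real_of_int a" "B = real_of_int b" "C = real_of_int c" "D = real_of_int d"
  have s: "B < D" "D < A" "A < C" using assms by (auto simp: ABCD)
  define x where "x = (C * D - A * B) / (C + D - A - B)"
  have p: "0 < C + D - A - B" using s by auto
  have e: "(x - B) * (A - x) = (x - D) * (C - x)"
  proof -
    have "x * (C + D - A - B) = C * D - A * B" using p by (simp add: x_def)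
    then show ?thesis by (simp add: algebra_simps)
  qed
  have "D * (C + D - A - B) \<le> C * D - A * B"
  proof -
    have "0 \<le> (A - D) * (D - B)" using s by simp
    then show ?thesis by (simp add: algebra_simps)
  qed
  then have xD: "D \<le> x" using p by (simp add: x_def le_divide_eq)
  have "C * D - A * B \<le> A * (C + D - A - B)"
  proof -
    have "0 \<le> (A - D) * (C - A)" using s by simp
    then show ?thesis by (simp add: algebra_simps)
  qed
  then have xA: "x \<le> A" using p by (simp add: x_def divide_le_eq)
  define y where "y = sqrt ((x - B) * (A - x))"
  have "0 \<le> (x - B) * (A - x)" using xD xA s by simp
  then have "0 \<le> y" "y\<^sup>2 = (x - B) * (A - x)" by (auto simp: y_def)
  then have "(x, y) \<in> cap_arc (b, a)" "(x, y) \<in> cap_arc (d, c)"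
    using e by (simp_all add: cap_arc_iff ABCD)
  then show ?thesis by blast
qed

lemma cap_arc_ends:
  assumes "b \<le> a"
  shows "(of_int b, 0) \<in> cap_arc (b, a)" "(of_int a, 0) \<in> cap_arc (b, a)"
  using assms by (simp_all add: cap_arc_iff)

lemma cap_arcs_disjoint_iff:
  assumes "b < a" "d < c"
  shows "cap_arc (b, a) \<inter> cap_arc (d, c) = {} \<longleftrightarrow>
     a < d \<or> c < b \<or> (b < d \<and> c < a) \<or> (d < b \<and> a < c)"
proof
  assume dis: "cap_arc (b, a) \<inter> cap_arc (d, c) = {}"
  have "b \<noteq> d" "b \<noteq> c" "a \<noteq> d" "a \<noteq> c"
    using dis cap_arc_ends[of b a] cap_arc_ends[of d c] assms by auto
  moreover have "\<not> (b < d \<and> d < a \<and> a < c)" "\<not> (d < b \<and> b < c \<and> c < a)"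
    using dis cap_arcs_crossing[of b d a c] cap_arcs_crossing[of d b c a] by auto
  ultimately show "a < d \<or> c < b \<or> (b < d \<and> c < a) \<or> (d < b \<and> a < c)" by linarith
next
  assume "a < d \<or> c < b \<or> (b < d \<and> c < a) \<or> (d < b \<and> a < c)"
  then consider "a < d" | "c < b" | "b < d" "c < a" | "d < b" "a < c" by blast
  then show "cap_arc (b, a) \<inter> cap_arc (d, c) = {}"
  proof cases
    case 1
    have False if "(x, y) \<in> cap_arc (b, a)" "(x, y) \<in> cap_arc (d, c)" for x y
      using cap_arc_range[OF that(1)] cap_arc_range[OF that(2)] assms 1 by linarith
    then show ?thesis by auto
  next
    case 2
    have False if "(x, y) \<in> cap_arc (b, a)" "(x, y) \<in> cap_arc (d, c)" for x y
      using cap_arc_range[OF that(1)] cap_arc_range[OF that(2)] assms 2 by linarith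
    then show ?thesis by auto
  next
    case 3
    then show ?thesis using cap_arcs_nested assms by blast
  next
    case 4
    then show ?thesis using cap_arcs_nested assms by blast
  qed
qed

lemma cap_diagramD:
  assumes "cap_diagram CL CR D"
  shows "finite D"
    and "(b, a) \<in> D \<Longrightarrow> b < a \<and> b \<notin> CL \<union> CR \<and> a \<notin> CL \<union> CR"
    and "(b, a) \<in> D \<Longrightarrow> (d, c) \<in> D \<Longrightarrow> (b, a) \<noteq> (d, c) \<Longrightarrow>
           a < d \<or> c < b \<or> (b < d \<and> c < a) \<or> (d < b \<and> a < c)"
    and "(b, a) \<in> D \<Longrightarrow> b < n \<Longrightarrow> n < a \<Longrightarrow> n \<in> cap_ends (D - {(b, a)}) \<union> (CL \<union> CR)"
proof -
  show "finite D" using assms by (simp add: cap_diagram_def)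
  show *: "b < a \<and> b \<notin> CL \<union> CR \<and> a \<notin> CL \<union> CR" if "(b, a) \<in> D" for b a
    using assms that by (auto simp: cap_diagram_def)
  show "a < d \<or> c < b \<or> (b < d \<and> c < a) \<or> (d < b \<and> a < c)"
    if "(b, a) \<in> D" "(d, c) \<in> D" "(b, a) \<noteq> (d, c)"
    using cap_arcs_disjoint_iff[of b a d c] *[OF that(1)] *[OF that(2)] assms that
    by (auto simp: cap_diagram_def)
  show "n \<in> cap_ends (D - {(b, a)}) \<union> (CL \<union> CR)" if "(b, a) \<in> D" "b < n" "n < a"
    using assms that unfolding cap_diagram_def by blast
qed

lemma cap_diagramI:
  assumes "finite D"
    and "\<And>b a. (b, a) \<in> D \<Longrightarrow> b < a \<and> b \<notin> CL \<union> CR \<and> a \<notin> CL \<union> CR"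
    and "\<And>b a d c. (b, a) \<in> D \<Longrightarrow> (d, c) \<in> D \<Longrightarrow> (b, a) \<noteq> (d, c) \<Longrightarrow>
           a < d \<or> c < b \<or> (b < d \<and> c < a) \<or> (d < b \<and> a < c)"
    and "\<And>b a n. (b, a) \<in> D \<Longrightarrow> b < n \<Longrightarrow> n < a \<Longrightarrow> n \<in> cap_ends (D - {(b, a)}) \<union> (CL \<union> CR)"
  shows "cap_diagram CL CR D"
proof -
  have "cap_arc p \<inter> cap_arc q = {}" if "p \<in> D" "q \<in> D" "p \<noteq> q" for p q
    using cap_arcs_disjoint_iff[of "fst p" "snd p" "fst q" "snd q"]
      assms(2)[of "fst p" "snd p"] assms(2)[of "fst q" "snd q"]
      assms(3)[of "fst p" "snd p" "fst q" "snd q"] that by simp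
  then show ?thesis using assms(1,2,4) unfolding cap_diagram_def by blast
qed

lemma cap_ends_iff: "n \<in> cap_ends D \<longleftrightarrow> (\<exists>b a. (b, a) \<in> D \<and> (n = b \<or> n = a))"
  by (force simp: cap_ends_def)

lemma cap_diagram_insert:
  assumes D: "cap_diagram CL CR D" and b: "\<And>x. x \<in> fst ` D \<Longrightarrow> b < x" "b \<notin> CL \<union> CR"
    and a: "b < a" "a \<notin> CL \<union> CR" "a \<notin> cap_ends D"
    and u: "\<And>n. b < n \<Longrightarrow> n < a \<Longrightarrow> n \<in> cap_ends D \<union> (CL \<union> CR)"
  shows "cap_diagram CL CR (insert (b, a) D)"
proof -
  have bd: "b < d" if "(d, c) \<in> D" for d c using b(1)[of d] that by force
  have notin: "(b, a) \<notin> D" using bd by blast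
  have sep: "a < d \<or> c < a \<and> b < d" if dc: "(d, c) \<in> D" for d c
  proof -
    have "a \<noteq> d" "a \<noteq> c" using a(3) dc by (auto simp: cap_ends_iff)
    moreover have "\<not> (d < a \<and> a < c)"
      using cap_diagramD(4)[OF D dc, of a] a(2,3) by (auto simp: cap_ends_iff)
    ultimately show ?thesis using bd[OF dc] cap_diagramD(2)[OF D dc] by linarith
  qed
  show ?thesis
  proof (rule cap_diagramI)
    show "finite (insert (b, a) D)" using cap_diagramD(1)[OF D] by simp
    fix d c assume dc: "(d, c) \<in> insert (b, a) D"
    show "d < c \<and> d \<notin> CL \<union> CR \<and> c \<notin> CL \<union> CR"
      using dc a b cap_diagramD(2)[OF D] by blast
    show "n \<in> cap_ends (insert (b, a) D - {(d, c)}) \<union> (CL \<union> CR)" if "d < n" "n < c" for n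
    proof (cases "(d, c) = (b, a)")
      case True
      then have "insert (b, a) D - {(d, c)} = D" using notin by auto
      then show ?thesis using u that True by auto
    next
      case False
      then have "(d, c) \<in> D" using dc by auto
      then show ?thesis using cap_diagramD(4)[OF D, of d c n] that by (auto simp: cap_ends_def)
    qed
    fix d' c' assume dc': "(d', c') \<in> insert (b, a) D" and ne: "(d, c) \<noteq> (d', c')"
    show "c < d' \<or> c' < d \<or> (d < d' \<and> c' < c) \<or> (d' < d \<and> c < c')"
      using dc dc' ne sep[of d c] sep[of d' c'] cap_diagramD(3)[OF D, of d c d' c'] by auto
  qed
qed

lemma cap_diagram_remove:
  assumes D: "cap_diagram CL CR D" and ba: "(b, a) \<in> D" and b: "\<And>d c. (d, c) \<in> D \<Longrightarrow> b \<le> d"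
  shows "cap_diagram CL CR (D - {(b, a)})"
proof (rule cap_diagramI)
  show "finite (D - {(b, a)})" using cap_diagramD(1)[OF D] by simp
  fix d c assume dc: "(d, c) \<in> D - {(b, a)}"
  show "d < c \<and> d \<notin> CL \<union> CR \<and> c \<notin> CL \<union> CR" using cap_diagramD(2)[OF D, of d c] dc by blast
  show "n \<in> cap_ends (D - {(b, a)} - {(d, c)}) \<union> (CL \<union> CR)" if n: "d < n" "n < c" for n
  proof -
    have "n \<noteq> b" using b[of d c] dc n by auto
    moreover have "n \<noteq> a" using cap_diagramD(3)[OF D ba, of d c] b[of d c] dc n by auto
    moreover have "n \<in> cap_ends (D - {(d, c)}) \<union> (CL \<union> CR)"
      using cap_diagramD(4)[OF D, of d c n] dc n by auto
    ultimately show ?thesis by (auto simp: cap_ends_iff)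
  qed
  fix d' c' assume dc': "(d', c') \<in> D - {(b, a)}" and ne: "(d, c) \<noteq> (d', c')"
  show "c < d' \<or> c' < d \<or> (d < d' \<and> c' < c) \<or> (d' < d \<and> c < c')"
    using cap_diagramD(3)[OF D, of d c d' c'] dc dc' ne by auto
qed

lemma cap_diagram_start_unique:
  assumes "cap_diagram CL CR D" "(b, a) \<in> D" "(b, a') \<in> D"
  shows "a = a'"
  using cap_diagramD(3)[OF assms(1), of b a b a'] cap_diagramD(2)[OF assms(1)] assms(2,3) by fastforce

lemma cap_diagram_ends_disjoint:
  assumes "cap_diagram CL CR D" "(b, a) \<in> D"
  shows "b \<notin> cap_ends (D - {(b, a)})" "a \<notin> cap_ends (D - {(b, a)})"
proof -
  have "b \<noteq> d \<and> b \<noteq> c \<and> a \<noteq> d \<and> a \<noteq> c" if "(d, c) \<in> D - {(b, a)}" for d c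
    using cap_diagramD(3)[OF assms, of d c] cap_diagramD(2)[OF assms]
      cap_diagramD(2)[OF assms(1), of d c] that by auto
  then show "b \<notin> cap_ends (D - {(b, a)})" "a \<notin> cap_ends (D - {(b, a)})"
    by (auto simp: cap_ends_iff)
qed

lemma ex1_cap_diagram:
  assumes "finite X" "finite CL" "finite CR" "X \<inter> (CL \<union> CR) = {}"
  shows "\<exists>!D. cap_diagram CL CR D \<and> fst ` D = X"
  using assms(1,4)
proof (induction X rule: finite_linorder_min_induct)
  case empty
  then show ?case by (auto simp: cap_diagram_def)
next
  case (insert b X)
  then have bX: "\<And>x. x \<in> X \<Longrightarrow> b < x" and bC: "b \<notin> CL \<union> CR" by auto
  have "\<exists>!D. cap_diagram CL CR D \<and> fst ` D = X"
    by (rule insert.IH) (use insert.prems in blast)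
  then obtain D where D': "cap_diagram CL CR D \<and> fst ` D = X"
    and uniq': "\<forall>E. cap_diagram CL CR E \<and> fst ` E = X \<longrightarrow> E = D"
    by (elim ex1E) (rule that)
  have D: "cap_diagram CL CR D" "fst ` D = X" using D' by simp_all
  have uniq: "\<And>E. cap_diagram CL CR E \<Longrightarrow> fst ` E = X \<Longrightarrow> E = D" using uniq' by simp
  have finE: "finite (cap_ends D \<union> (CL \<union> CR))"
    using cap_diagramD(1)[OF D(1)] assms by (simp add: cap_ends_def)
  define S where "S = {k::nat. b + 1 + int k \<notin> cap_ends D \<union> (CL \<union> CR)}"
  have "\<exists>k. k \<in> S"
  proof (rule ccontr)
    assume "\<not> (\<exists>k. k \<in> S)"
    then have "range (\<lambda>k. b + 1 + int k) \<subseteq> cap_ends D \<union> (CL \<union> CR)" by (auto simp: S_def)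
    then have "finite (range (\<lambda>k. b + 1 + int k))" using finE by (rule finite_subset)
    moreover have "inj (\<lambda>k. b + 1 + int k)" by (auto simp: inj_def)
    ultimately show False using finite_imageD by fastforce
  qed
  then have LS: "(LEAST k. k \<in> S) \<in> S" by (auto intro: LeastI)
  define a where "a = b + 1 + int (LEAST k. k \<in> S)"
  have a: "b < a" "a \<notin> CL \<union> CR" "a \<notin> cap_ends D" using LS by (auto simp: a_def S_def)
  have u: "n \<in> cap_ends D \<union> (CL \<union> CR)" if "b < n" "n < a" for n
  proof -
    have "nat (n - b - 1) < (LEAST k. k \<in> S)" using that by (simp add: a_def)
    then have "nat (n - b - 1) \<notin> S" by (rule not_less_Least)
    then show ?thesis using that by (simp add: S_def)
  qed
  show ?case
  proof (rule ex1I[of _ "Set.insert (b, a) D"])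
    show "cap_diagram CL CR (Set.insert (b, a) D) \<and> fst ` Set.insert (b, a) D = Set.insert b X"
      using cap_diagram_insert[OF D(1) _ bC a u] bX D(2) by auto
    fix E assume E: "cap_diagram CL CR E \<and> fst ` E = Set.insert b X"
    then obtain a' where ba': "(b, a') \<in> E" by force
    have le: "b \<le> d" if "(d, c) \<in> E" for d c
    proof -
      have "d \<in> fst ` E" using that by force
      then show ?thesis using E bX by fastforce
    qed
    have rem: "cap_diagram CL CR (E - {(b, a')})"
      using cap_diagram_remove[of CL CR E b a'] E ba' le by blast
    have "x \<noteq> b" if "(x, y) \<in> E - {(b, a')}" for x y
      using cap_diagram_start_unique[of CL CR E b a' y] E ba' that by blast
    then have "fst ` (E - {(b, a')}) = fst ` E - {b}"
      by force
    also have "\<dots> = X" using E bX by auto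
    finally have im: "fst ` (E - {(b, a')}) = X" .
    from rem im have ED: "E - {(b, a')} = D" by (rule uniq)
    have a'1: "b < a'" "a' \<notin> CL \<union> CR" using cap_diagramD(2)[of CL CR E b a'] E ba' by auto
    have a'2: "a' \<notin> cap_ends D" using cap_diagram_ends_disjoint(2)[of CL CR E b a'] E ba' ED by auto
    have "\<not> a' < a" using u[of a'] a'1 a'2 by auto
    moreover have "\<not> a < a'"
      using cap_diagramD(4)[of CL CR E b a' a] E ba' ED a by auto
    ultimately have "a' = a" by simp
    then show "E = Set.insert (b, a) D" using ED ba' by auto
  qed
qed

lemma D_cap:
  assumes "f \<in> weights"
  shows "cap_diagram (core_L f) (core_R f) (D_cap f)" "fst ` D_cap f = crosses f"
proof -
  have "crosses f \<inter> (core_L f \<union> core_R f) = {}"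
    by (auto simp: crosses_def core_L_def core_R_def)
  then have "\<exists>!D. cap_diagram (core_L f) (core_R f) D \<and> fst ` D = crosses f"
    using finite_crosses[OF assms] finite_core[OF assms] by (intro ex1_cap_diagram) auto
  then have "cap_diagram (core_L f) (core_R f) (D_cap f) \<and> fst ` D_cap f = crosses f"
    unfolding D_cap_def by (rule theI')
  then show "cap_diagram (core_L f) (core_R f) (D_cap f)" "fst ` D_cap f = crosses f" by auto
qed

lemma card_D_cap:
  assumes "f \<in> weights"
  shows "card (D_cap f) = num_crosses f"
proof -
  have "inj_on fst (D_cap f)"
    using cap_diagram_start_unique[OF D_cap(1)[OF assms]] by (auto simp: inj_on_def)
  then show ?thesis
    using D_cap(2)[OF assms] card_image by (fastforce simp: num_crosses_def)
qed

lemma weight_eqI: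
  assumes "core f = core g" "crosses f = crosses g"
  shows "f = g"
proof
  fix n
  have sets: "{a. f a = Greater} = {a. g a = Greater}" "{a. f a = Less} = {a. g a = Less}"
      "{a. f a = Cross} = {a. g a = Cross}"
    using assms by (simp_all only: core_def core_L_def core_R_def crosses_def prod.inject)
  have "f n = Greater \<longleftrightarrow> g n = Greater" "f n = Less \<longleftrightarrow> g n = Less" "f n = Cross \<longleftrightarrow> g n = Cross"
    using sets by blast+
  then show "f n = g n"
    by (cases "f n"; cases "g n") simp_all
qed

lemma finite_P_set:
  assumes f: "f \<in> weights"
  shows "finite (P_set f)"
proof (cases "crosses f = {}")
  case True
  have "P_set f \<subseteq> {f}"
  proof
    fix g assume g: "g \<in> P_set f"
    then have "core g = core f" "num_crosses g = 0" "finite (crosses g)"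
      using True finite_crosses by (auto simp: P_set_def matches_def num_crosses_def)
    then show "g \<in> {f}" using True by (auto intro!: weight_eqI simp: num_crosses_def)
  qed
  then show ?thesis by (rule finite_subset) simp
next
  case False
  define N where "N = 2 * int (num_crosses f) + int (card (core_L f \<union> core_R f)) + 1"
  define lo hi where "lo = Min (crosses f)" and "hi = Max (crosses f)"
  have "crosses g \<subseteq> {lo - N..hi}" if g: "g \<in> P_set f" for g
  proof
    fix b assume b: "b \<in> crosses g"
    have gw: "g \<in> weights" and co: "core_L g = core_L f" "core_R g = core_R f"
      and k: "num_crosses g = num_crosses f"
      and m: "\<And>b a. (b, a) \<in> D_cap g \<Longrightarrow> f b = Cross \<or> f a = Cross"
      using g by (auto simp: P_set_def matches_def core_def)
    note D = D_cap[OF gw]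
    from b D(2) obtain a where ba: "(b, a) \<in> D_cap g" by force
    have lt: "b < a" using cap_diagramD(2)[OF D(1) ba] by simp
    have fin: "finite (D_cap g)" using cap_diagramD(1)[OF D(1)] .
    have "{b<..<a} \<subseteq> (fst ` D_cap g \<union> snd ` D_cap g) \<union> (core_L f \<union> core_R f)"
      using cap_diagramD(4)[OF D(1) ba] co by (auto simp: cap_ends_iff) force+
    then have "card {b<..<a} \<le> card ((fst ` D_cap g \<union> snd ` D_cap g) \<union> (core_L f \<union> core_R f))"
      using fin finite_core[OF f] by (intro card_mono) auto
    also have "\<dots> \<le> card (fst ` D_cap g) + card (snd ` D_cap g) + card (core_L f \<union> core_R f)"
      by (meson card_Un_le le_trans add_le_mono le_refl)
    also have "\<dots> \<le> 2 * num_crosses f + card (core_L f \<union> core_R f)"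
      using card_image_le[OF fin, of fst] card_image_le[OF fin, of snd] card_D_cap[OF gw] k by simp
    finally have "a \<le> b + N" using lt by (simp add: N_def)
    moreover have "lo \<le> b \<and> b \<le> hi \<or> lo \<le> a \<and> a \<le> hi"
      using m[OF ba] finite_crosses[OF f] by (auto simp: lo_def hi_def crosses_def)
    moreover have "0 \<le> N" by (simp add: N_def)
    ultimately show "b \<in> {lo - N..hi}" using lt by auto
  qed
  then have "crosses ` P_set f \<subseteq> Pow {lo - N..hi}" by auto
  then have "finite (crosses ` P_set f)" by (rule finite_subset) simp
  moreover have "inj_on crosses (P_set f)"
    by (auto simp: inj_on_def P_set_def matches_def intro: weight_eqI)
  ultimately show ?thesis by (rule finite_imageD)
qed

end

theory Submission
  imports Defs
begin

text \<open>Scan the number line from left to right. For a position \<open>n\<close> consider the diagrams \<open>g\<close> that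
  agree with \<open>f\<close> from \<open>n\<close> on, whose caps ending before \<open>n\<close> match \<open>f\<close>, and whose open crosses at
  \<open>n\<close> (those whose cap ends at \<open>n\<close> or later) are crosses of \<open>f\<close>. Far to the left \<open>f\<close> is the only one,
  far to the right they form \<open>P(f)\<close>. The set only changes when \<open>n\<close> passes a cross \<open>a\<^sub>i\<close> of \<open>f\<close>, and
  \<open>1 + \<sigma>\<^sub>i\<close> accounts for the change: a legal move from \<open>n\<close> to \<open>b\<close> is one after which \<open>b\<close> is an open
  cross at \<open>n\<close>, and its weight counts the open crosses between \<open>b\<close> and \<open>n\<close>. If some moves end in
  \<open>g\<close>, then exactly one open cross \<open>s\<close> of \<open>g\<close> is not a cross of \<open>f\<close>, and these moves end at \<open>s\<close> or
  at the next open cross to the right of it. The two cancel, unless \<open>s\<close> is the last open cross,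
  and then \<open>g\<close> belongs to the new set.\<close>

section \<open>Move weights as heights of a lattice path\<close>

text \<open>Read from left to right, each symbol is a step of a lattice path.
  \<open>move_weight f b c\<close> is the height of this path at \<open>c\<close>, measured from
  height 0 at \<open>b + 1\<close>; the arguments below are about such heights.\<close>

fun charge :: "symbol \<Rightarrow> int"
  where "charge Cross = 1" | "charge Circ = - 1" | "charge Less = 0" | "charge Greater = 0"

lemma move_weight_eq_sum: "move_weight f b a = (\<Sum>n\<in>{b<..<a}. charge (f n))"
proof -
  have ch: "charge s = of_bool (s = Cross) - of_bool (s = Circ)" for s
    by (cases s) auto
  have eq: "{n. b < n \<and> n < a \<and> f n = s} = {b<..<a} \<inter> {n. f n = s}" for s
    by auto
  show ?thesis
    unfolding move_weight_def eq by (simp add: ch sum_subtractf of_bool_def sum.If_cases)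
qed

lemma move_weight_adjacent [simp]: "move_weight f b (b + 1) = 0"
proof -
  have "{b<..<b + 1} = {}" by auto
  then show ?thesis by (simp add: move_weight_eq_sum)
qed

lemma move_weight_split:
  assumes "b < m" "m < a"
  shows "move_weight f b a = move_weight f b m + charge (f m) + move_weight f m a"
proof -
  have "{b<..<a} = {b<..<m} \<union> insert m {m<..<a}" using assms by auto
  then show ?thesis
    unfolding move_weight_eq_sum by (simp add: sum.union_disjoint disjoint_iff)
qed

lemma move_weight_Suc: "b < a \<Longrightarrow> move_weight f b (a + 1) = move_weight f b a + charge (f a)"
  using move_weight_split[of b a "a + 1" f] by simp

lemma move_weight_cong:
  "(\<And>n. b < n \<Longrightarrow> n < a \<Longrightarrow> f n = g n) \<Longrightarrow> move_weight f b a = move_weight g b a"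
  unfolding move_weight_eq_sum by (intro sum.cong) auto

text \<open>The step at \<open>b\<close> turns from up to down, which lowers by 2 every height
  measured across \<open>b\<close>. A height at \<open>c \<le> n\<close> sees only symbols left of
  \<open>n\<close>, so \<open>h\<close> may differ from \<open>g\<close> from \<open>n\<close>
  on.\<close>

lemma move_weight_drop_cross:
  assumes "g b = Cross" "\<And>m. m < n \<Longrightarrow> m \<noteq> b \<Longrightarrow> h m = g m" "h b = Circ" "c \<le> n"
  shows "move_weight h x c = move_weight g x c - (if x < b \<and> b < c then 2 else 0)"
proof (cases "x < b \<and> b < c")
  case True
  have "move_weight h x b = move_weight g x b" "move_weight h b c = move_weight g b c"
    using assms True by (auto intro!: move_weight_cong)
  then show ?thesis
    using True assms move_weight_split[of x b c] by simp
next
  case False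
  then show ?thesis using assms by (auto intro!: move_weight_cong)
qed

text \<open>The last clause of \<open>legal_move\<close>, separated from the symbols at the two ends
  so that caps and open crosses can share it.\<close>

definition nonneg_upto :: "(int \<Rightarrow> symbol) \<Rightarrow> int \<Rightarrow> int \<Rightarrow> bool"
  where "nonneg_upto g b a \<longleftrightarrow> (\<forall>c. b < c \<and> c \<le> a \<longrightarrow> 0 \<le> move_weight g b c)"

lemma nonneg_uptoD: "nonneg_upto g b a \<Longrightarrow> b < c \<Longrightarrow> c \<le> a \<Longrightarrow> 0 \<le> move_weight g b c"
  by (simp add: nonneg_upto_def)

lemma nonneg_upto_Suc:
  "b < a \<Longrightarrow> nonneg_upto g b (a + 1) \<longleftrightarrow> nonneg_upto g b a \<and> 0 \<le> move_weight g b a + charge (g a)"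
proof -
  assume "b < a"
  then have "b < c \<and> c \<le> a + 1 \<longleftrightarrow> b < c \<and> c \<le> a \<or> c = a + 1" for c by auto
  then show ?thesis
    using \<open>b < a\<close> by (auto simp: nonneg_upto_def move_weight_Suc)
qed

text \<open>A discrete intermediate value argument: take the last position with height at most
  \<open>t\<close>. The path must rise above \<open>t\<close> right after it, and a step rises by at
  most 1, so a cross stands there at height exactly \<open>t\<close>. As the path stays above
  \<open>t\<close> up to \<open>n\<close>, its heights measured from this cross are
  nonnegative.\<close>

lemma ex_last_level:
  assumes bn: "b < n" and t: "0 \<le> t" "t < move_weight g b n"
  shows "\<exists>x. b < x \<and> x < n \<and> g x = Cross \<and> move_weight g b x = t \<and> nonneg_upto g x n"
proof -
  define S where "S = {c. b < c \<and> c \<le> n \<and> move_weight g b c \<le> t}"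
  have fin: "finite S" by (rule finite_subset[of _ "{b..n}"]) (auto simp: S_def)
  have "b + 1 \<in> S" using bn t by (simp add: S_def)
  then have "Max S \<in> S" using fin Max_in by blast
  define x where "x = Max S"
  have x: "b < x" "x < n" "move_weight g b x \<le> t"
    using \<open>Max S \<in> S\<close> t by (auto simp: S_def x_def order.order_iff_strict)
  have above: "t < move_weight g b c" if "x < c" "c \<le> n" for c
  proof -
    have "c \<notin> S" using Max_ge[OF fin, of c] that by (auto simp: x_def)
    then show ?thesis using that x by (auto simp: S_def)
  qed
  have "t < move_weight g b x + charge (g x)"
    using above[of "x + 1"] x by (simp add: move_weight_Suc)
  then have *: "g x = Cross" "move_weight g b x = t"
    using x by (cases "g x"; simp)+
  have "0 \<le> move_weight g x c" if "x < c" "c \<le> n" for c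
    using above[OF that] move_weight_split[of b x c g] that x * by simp
  then show ?thesis using x * by (auto simp: nonneg_upto_def)
qed

section \<open>Caps described by heights\<close>

text \<open>This is bracket matching: \<open>a\<close> is the circle whose down step first takes the
  path from \<open>b\<close> below zero, at \<open>a + 1\<close>.\<close>

definition is_cap :: "(int \<Rightarrow> symbol) \<Rightarrow> int \<Rightarrow> int \<Rightarrow> bool"
  where "is_cap g b a \<longleftrightarrow>
    b < a \<and> g b = Cross \<and> g a = Circ \<and> nonneg_upto g b a \<and> move_weight g b a = 0"

lemma is_cap_not_nonneg_upto:
  assumes "is_cap g b a" "a < c"
  shows "\<not> nonneg_upto g b c"
  using assms nonneg_uptoD[of g b c "a + 1"] by (auto simp: is_cap_def move_weight_Suc)

text \<open>Otherwise the height from \<open>d\<close> is still nonnegative at \<open>a\<close>, and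
  the up step at \<open>d\<close> makes the height from \<open>b\<close> at \<open>a\<close> at
  least 1 instead of 0.\<close>

lemma is_cap_nested:
  assumes "is_cap g b a" "is_cap g d c" "b < d" "d < a"
  shows "c < a"
proof (rule ccontr)
  assume "\<not> c < a"
  then have "0 \<le> move_weight g d a" "0 \<le> move_weight g b d"
    using assms by (auto simp: is_cap_def nonneg_upto_def)
  then show False
    using move_weight_split[of b d a g] assms by (simp add: is_cap_def)
qed

text \<open>Far to the right \<open>g\<close> has only circles and the path keeps falling, so it
  becomes negative; the first negative height gives the end of the cap.\<close>

lemma ex_is_cap:
  assumes g: "g \<in> weights" and b: "g b = Cross"
  shows "\<exists>a. is_cap g b a"
proof -
  obtain M where M: "\<And>n. g n \<noteq> Circ \<Longrightarrow> n < M"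
  proof -
    have "finite {n. g n \<noteq> Circ}" using g by (simp add: weights_def)
    then have "\<And>n. g n \<noteq> Circ \<Longrightarrow> n < Max {n. g n \<noteq> Circ} + 1"
      using Max_ge by simp
    then show ?thesis using that by blast
  qed
  have bM: "b < M" using M b by simp
  have far: "move_weight g b (M + int k) = move_weight g b M - int k" for k
  proof (induction k)
    case (Suc k)
    have "g (M + int k) = Circ" using M[of "M + int k"] by auto
    then show ?case
      using Suc bM move_weight_Suc[of b "M + int k" g] by (simp add: algebra_simps)
  qed simp
  define S where "S = {j. move_weight g b (b + 1 + int j) < 0}"
  have "\<exists>j. j \<in> S"
  proof -
    define K where "K = nat (move_weight g b M) + 1"
    have "move_weight g b (M + int K) < 0" using far[of K] by (simp add: K_def)
    then have "nat (M + int K - b - 1) \<in> S" using bM by (simp add: S_def)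
    then show ?thesis ..
  qed
  then have L: "(LEAST j. j \<in> S) \<in> S" by (auto intro: LeastI)
  \<comment> \<open>\<open>S\<close> counts positions from \<open>b + 1\<close>, so the first
    negative height is at \<open>a + 1\<close> and the step that causes it is the one at
    \<open>a\<close>.\<close>
  define a where "a = b + int (LEAST j. j \<in> S)"
  have neg: "move_weight g b (a + 1) < 0" using L by (simp add: a_def S_def algebra_simps)
  have pos: "0 \<le> move_weight g b c" if "b < c" "c \<le> a" for c
  proof -
    have "nat (c - b - 1) \<notin> S"
      by (rule not_less_Least) (use that in \<open>simp add: a_def\<close>)
    then show ?thesis using that by (simp add: S_def)
  qed
  have "b < a"
  proof (rule ccontr)
    assume "\<not> b < a"
    then have "a = b" by (simp add: a_def)
    then show False using neg by simp
  qed
  moreover have "g a = Circ \<and> move_weight g b a = 0"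
    using neg pos[of a] \<open>b < a\<close> by (cases "g a") (auto simp: move_weight_Suc)
  ultimately show ?thesis using b pos by (auto simp: is_cap_def nonneg_upto_def)
qed

text \<open>By \<open>ex1_cap_diagram\<close> it suffices that the pairs satisfying
  \<open>is_cap\<close> form a cap diagram whose caps begin at the crosses.\<close>

lemma D_cap_iff:
  assumes g: "g \<in> weights"
  shows "(b, a) \<in> D_cap g \<longleftrightarrow> is_cap g b a"
proof -
  define D where "D = {(b, a). is_cap g b a}"
  have uniq: "a = c" if "is_cap g b a" "is_cap g b c" for b a c
    using is_cap_not_nonneg_upto[OF that(1), of c] is_cap_not_nonneg_upto[OF that(2), of a] that
    by (cases a c rule: linorder_cases) (simp_all add: is_cap_def)
  have core: "n \<in> core_L g \<union> core_R g \<longleftrightarrow> g n \<noteq> Cross \<and> g n \<noteq> Circ" for n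
    by (cases "g n") (auto simp: core_L_def core_R_def)
  have img: "fst ` D = crosses g"
    using ex_is_cap[OF g] by (force simp: D_def crosses_def is_cap_def)
  have "cap_diagram (core_L g) (core_R g) D"
  proof (rule cap_diagramI)
    have "inj_on fst D" using uniq by (auto simp: inj_on_def D_def)
    then show "finite D" using img finite_crosses[OF g] finite_imageD by metis
    fix b a assume ba: "(b, a) \<in> D"
    then have cap: "is_cap g b a" by (simp add: D_def)
    then show "b < a \<and> b \<notin> core_L g \<union> core_R g \<and> a \<notin> core_L g \<union> core_R g"
      unfolding core by (simp add: is_cap_def)
    show "a < d \<or> c < b \<or> b < d \<and> c < a \<or> d < b \<and> a < c"
      if "(d, c) \<in> D" "(b, a) \<noteq> (d, c)" for d c
    proof -
      have cap': "is_cap g d c" using that by (simp add: D_def)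
      have "b \<noteq> d" using uniq cap cap' that by auto
      moreover have "a \<noteq> d" "c \<noteq> b" using cap cap' by (auto simp: is_cap_def)
      ultimately show ?thesis
        using is_cap_nested[OF cap cap'] is_cap_nested[OF cap' cap] by linarith
    qed
    show "n \<in> cap_ends (D - {(b, a)}) \<union> (core_L g \<union> core_R g)" if n: "b < n" "n < a" for n
    proof (cases "g n = Cross")
      case True
      then show ?thesis using ex_is_cap[OF g True] n by (auto simp: cap_ends_iff D_def)
    next
      case False
      show ?thesis
      proof (cases "g n = Circ")
        case True
        have "0 \<le> move_weight g b (n + 1)"
          using cap n by (auto simp: is_cap_def intro: nonneg_uptoD)
        then have "1 \<le> move_weight g b n" using True n by (simp add: move_weight_Suc)
        \<comment> \<open>The last cross one level below the height at \<open>n\<close> is the start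
          of the cap that the circle at \<open>n\<close> closes.\<close>
        then obtain x where x: "b < x" "x < n" "g x = Cross" "move_weight g b x = move_weight g b n - 1"
          "nonneg_upto g x n"
          using ex_last_level[of b n "move_weight g b n - 1" g] n by auto
        have "is_cap g x n"
          using x True move_weight_split[of b x n g] by (simp add: is_cap_def)
        then show ?thesis using x by (auto simp: cap_ends_iff D_def)
      next
        case False
        then show ?thesis using \<open>g n \<noteq> Cross\<close> core by blast
      qed
    qed
  qed
  moreover have "\<exists>!D. cap_diagram (core_L g) (core_R g) D \<and> fst ` D = crosses g"
    using finite_crosses[OF g] finite_core[OF g]
    by (intro ex1_cap_diagram) (auto simp: crosses_def core_L_def core_R_def)
  ultimately have "D_cap g = D" using img D_cap[OF g] by blast
  then show ?thesis by (simp add: D_def)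
qed

section \<open>Matching expressed by caps and crosses\<close>

definition mixed :: "(int \<Rightarrow> symbol) \<Rightarrow> int \<Rightarrow> int \<Rightarrow> bool"
  where "mixed f b a \<longleftrightarrow> (f b = Cross \<and> f a = Circ) \<or> (f b = Circ \<and> f a = Cross)"

lemma core_eqD:
  assumes "core g = core f"
  shows "g n = Cross \<or> g n = Circ \<longleftrightarrow> f n = Cross \<or> f n = Circ"
    and "f n \<noteq> Cross \<Longrightarrow> f n \<noteq> Circ \<Longrightarrow> g n = f n"
proof -
  have "g n = Greater \<longleftrightarrow> f n = Greater" "g n = Less \<longleftrightarrow> f n = Less"
    using assms by (auto simp: core_def core_L_def core_R_def)
  then show "g n = Cross \<or> g n = Circ \<longleftrightarrow> f n = Cross \<or> f n = Circ"
    and "f n \<noteq> Cross \<Longrightarrow> f n \<noteq> Circ \<Longrightarrow> g n = f n"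
    by (cases "g n"; cases "f n"; simp)+
qed

text \<open>Every cap of a matching diagram carries exactly one cross of \<open>f\<close>, so equality of the numbers
  of crosses says that every cross of \<open>f\<close> lies on a cap.\<close>

lemma matches_iff:
  assumes f: "f \<in> weights" and g: "g \<in> weights"
  shows "matches g f \<longleftrightarrow> core g = core f \<and> (\<forall>b a. is_cap g b a \<longrightarrow> mixed f b a) \<and>
    (\<forall>n. f n = Cross \<longrightarrow> (\<exists>b a. is_cap g b a \<and> (n = b \<or> n = a)))"
proof -
  have m: "matches g f \<longleftrightarrow> core g = core f \<and> num_crosses g = num_crosses f \<and>
      (\<forall>b a. is_cap g b a \<longrightarrow> mixed f b a)"
    by (simp add: matches_def mixed_def Ball_def D_cap_iff[OF g] split_paired_All)
  show ?thesis
  proof (cases "core g = core f \<and> (\<forall>b a. is_cap g b a \<longrightarrow> mixed f b a)")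
    case True
    \<comment> \<open>\<open>e\<close> chooses the end of a cap that \<open>f\<close> labels by a
      cross. Caps share no ends, so \<open>e\<close> is injective and its image consists of
      \<open>num_crosses g\<close> crosses of \<open>f\<close>.\<close>
    define e where "e = (\<lambda>(b, a). if f b = Cross then b else a :: int)"
    note D = D_cap(1)[OF g]
    have mx: "mixed f b a" if "(b, a) \<in> D_cap g" for b a
      using True that D_cap_iff[OF g] by blast
    have "inj_on e (D_cap g)"
    proof (rule inj_onI)
      fix p q assume p: "p \<in> D_cap g" and q: "q \<in> D_cap g" and eq: "e p = e q"
      obtain b a d c where bc: "p = (b, a)" "q = (d, c)" by (cases p; cases q)
      show "p = q"
        using cap_diagramD(3)[OF D, of b a d c] cap_diagramD(2)[OF D, of b a]
          cap_diagramD(2)[OF D, of d c] p q eq unfolding bc e_def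
        by (auto split: if_splits)
    qed
    then have card: "card (e ` D_cap g) = num_crosses g"
      using card_D_cap[OF g] by (simp add: card_image)
    have sub: "e ` D_cap g \<subseteq> crosses f"
      using mx by (force simp: e_def mixed_def crosses_def)
    have on_cap: "n \<in> e ` D_cap g \<longleftrightarrow> (\<exists>b a. (b, a) \<in> D_cap g \<and> (n = b \<or> n = a))"
      if "f n = Cross" for n
    proof
      assume "n \<in> e ` D_cap g"
      then obtain b a where ba: "(b, a) \<in> D_cap g" "n = e (b, a)" by auto
      then have "n = b \<or> n = a" by (simp add: e_def)
      then show "\<exists>b a. (b, a) \<in> D_cap g \<and> (n = b \<or> n = a)" using ba by blast
    next
      assume "\<exists>b a. (b, a) \<in> D_cap g \<and> (n = b \<or> n = a)"
      then obtain b a where ba: "(b, a) \<in> D_cap g" "n = b \<or> n = a" by blast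
      then have "e (b, a) = n" using mx[OF ba(1)] that by (auto simp: e_def mixed_def)
      then show "n \<in> e ` D_cap g" using ba by blast
    qed
    have "num_crosses g = num_crosses f \<longleftrightarrow> crosses f \<subseteq> e ` D_cap g"
      using card sub finite_crosses[OF f] card_subset_eq[of "crosses f" "e ` D_cap g"]
      unfolding num_crosses_def by (metis subset_antisym)
    also have "\<dots> \<longleftrightarrow> (\<forall>n. f n = Cross \<longrightarrow> (\<exists>b a. (b, a) \<in> D_cap g \<and> (n = b \<or> n = a)))"
      by (simp add: crosses_def subset_iff on_cap)
    finally show ?thesis
      using True by (simp add: m D_cap_iff[OF g])
  next
    case False
    then show ?thesis
      unfolding m by blast
  qed
qed

section \<open>Open crosses and partial matches\<close>

text \<open>Stated through heights, the condition that the cap from \<open>b\<close> does not end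
  before \<open>n\<close> depends only on the symbols left of \<open>n\<close>.\<close>

definition open_crosses :: "(int \<Rightarrow> symbol) \<Rightarrow> int \<Rightarrow> int set"
  where "open_crosses g n = {b. b < n \<and> g b = Cross \<and> nonneg_upto g b n}"

text \<open>The conditions of \<open>matches_iff\<close> as far as they are decided left of
  \<open>n\<close>: a cross of \<open>f\<close> may also wait at the start of a cap that is still
  open.\<close>

definition closed_below :: "(int \<Rightarrow> symbol) \<Rightarrow> (int \<Rightarrow> symbol) \<Rightarrow> int \<Rightarrow> bool"
  where "closed_below f g n \<longleftrightarrow>
    (\<forall>b a. is_cap g b a \<and> a < n \<longrightarrow> mixed f b a) \<and>
    (\<forall>m<n. f m = Cross \<longrightarrow> m \<in> open_crosses g n \<or> (\<exists>b a. is_cap g b a \<and> a < n \<and> (m = b \<or> m = a)))"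

text \<open>Since \<open>g\<close> agrees with \<open>f\<close> from \<open>n\<close> on, a cap
  reaching \<open>n\<close> or beyond from the left ends at a circle of \<open>f\<close>. It can be
  mixed only if it begins at a cross of \<open>f\<close>, whence the last condition.\<close>

definition partial_matches :: "(int \<Rightarrow> symbol) \<Rightarrow> int \<Rightarrow> (int \<Rightarrow> symbol) set"
  where "partial_matches f n = {g \<in> weights. core g = core f \<and> (\<forall>m\<ge>n. g m = f m) \<and>
    closed_below f g n \<and> open_crosses g n \<subseteq> crosses f}"

lemma cross_cases:
  assumes "g \<in> weights" "g b = Cross" "b < n"
  shows "b \<in> open_crosses g n \<or> (\<exists>a<n. is_cap g b a)"
proof -
  obtain a where a: "is_cap g b a" using ex_is_cap assms by blast
  show ?thesis
  proof (cases "a < n")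
    case False
    then have "nonneg_upto g b n" using a by (auto simp: is_cap_def nonneg_upto_def)
    then show ?thesis using assms by (simp add: open_crosses_def)
  qed (use a in blast)
qed

lemma is_cap_open_cross:
  assumes "is_cap g b a" "b < n" "n \<le> a"
  shows "b \<in> open_crosses g n"
  using assms by (auto simp: open_crosses_def is_cap_def nonneg_upto_def)

lemma is_cap_end_iff:
  "is_cap g b n \<longleftrightarrow> g n = Circ \<and> b \<in> open_crosses g n \<and> move_weight g b n = 0"
  by (auto simp: is_cap_def open_crosses_def)

lemma open_crosses_Suc:
  "open_crosses g (n + 1) = (if g n = Cross then {n} else {}) \<union>
     {b \<in> open_crosses g n. 0 \<le> move_weight g b n + charge (g n)}"
proof -
  have "0 \<le> move_weight g n c" if "n < c" "c \<le> n + 1" for c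
  proof -
    have "c = n + 1" using that by simp
    then show ?thesis by simp
  qed
  then have "nonneg_upto g n (n + 1)" by (simp add: nonneg_upto_def)
  moreover have "b < n + 1 \<longleftrightarrow> b < n \<or> b = n" for b by auto
  ultimately show ?thesis
    unfolding open_crosses_def using nonneg_upto_Suc[of _ n g] by auto
qed

lemma open_crosses_less_iff:
  assumes "b < n"
  shows "b \<in> open_crosses g n \<longleftrightarrow> b \<in> open_crosses g (n + 1) \<or> is_cap g b n"
proof -
  have "0 \<le> move_weight g b n" if "b \<in> open_crosses g n"
    using that by (auto simp: open_crosses_def nonneg_upto_def)
  then show ?thesis
    using assms unfolding is_cap_end_iff open_crosses_Suc by (cases "g n") auto
qed

text \<open>A cross that stops being open when \<open>n\<close> is passed begins a cap ending at
  \<open>n\<close>. So the crosses of \<open>f\<close> left of \<open>n\<close> stay accounted for,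
  and new conditions come only from \<open>n\<close> and the caps ending there.\<close>

lemma closed_below_Suc:
  "closed_below f g (n + 1) \<longleftrightarrow> closed_below f g n \<and> (\<forall>b. is_cap g b n \<longrightarrow> mixed f b n) \<and>
     (f n = Cross \<longrightarrow> n \<in> open_crosses g (n + 1) \<or> (\<exists>b. is_cap g b n))"
proof -
  define I where "I m k \<longleftrightarrow> (\<exists>b a. is_cap g b a \<and> a < k \<and> (m = b \<or> m = a))" for m k
  have lt: "b < a" if "is_cap g b a" for b a using that by (simp add: is_cap_def)
  have I1: "I m (n + 1) \<longleftrightarrow> I m n \<or> is_cap g m n" if "m < n" for m
    unfolding I_def using that by (auto simp: order.order_iff_strict)
  have I2: "I n (n + 1) \<longleftrightarrow> (\<exists>b. is_cap g b n)"
    unfolding I_def using lt by fastforce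
  have "(\<forall>m<n + 1. f m = Cross \<longrightarrow> m \<in> open_crosses g (n + 1) \<or> I m (n + 1)) \<longleftrightarrow>
      (\<forall>m<n. f m = Cross \<longrightarrow> m \<in> open_crosses g (n + 1) \<or> I m (n + 1)) \<and>
      (f n = Cross \<longrightarrow> n \<in> open_crosses g (n + 1) \<or> I n (n + 1))"
    unfolding zless_add1_eq by blast
  also have "\<dots> \<longleftrightarrow> (\<forall>m<n. f m = Cross \<longrightarrow> m \<in> open_crosses g n \<or> I m n) \<and>
      (f n = Cross \<longrightarrow> n \<in> open_crosses g (n + 1) \<or> (\<exists>b. is_cap g b n))"
    using I1 I2 open_crosses_less_iff[of _ n g] by blast
  moreover have "(\<forall>b a. is_cap g b a \<and> a < n + 1 \<longrightarrow> mixed f b a) \<longleftrightarrow>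
      (\<forall>b a. is_cap g b a \<and> a < n \<longrightarrow> mixed f b a) \<and> (\<forall>b. is_cap g b n \<longrightarrow> mixed f b n)"
    unfolding zless_add1_eq by blast
  ultimately show ?thesis
    unfolding closed_below_def I_def[symmetric] by blast
qed

text \<open>If \<open>u < v\<close> were two such crosses, the up step at \<open>v\<close> would put
  the height from \<open>u\<close> at \<open>b\<close> at 1 or more. Thus a circle at
  \<open>b\<close> closes at most one open cross, the nearest one.\<close>

lemma adjacent_unique:
  assumes "x \<in> open_crosses g n" "y \<in> open_crosses g n" "x < b" "y < b" "b \<le> n"
    "move_weight g x b = 0" "move_weight g y b = 0"
  shows "x = y"
proof -
  have "\<not> u < v" if "u \<in> open_crosses g n" "v \<in> open_crosses g n" "v < b"
    "move_weight g u b = 0" "move_weight g v b = 0" for u v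
    using that assms(5) move_weight_split[of u v b g] nonneg_uptoD[of g u n v]
    by (auto simp: open_crosses_def)
  then show ?thesis using assms linorder_neqE by metis
qed

section \<open>Passing one position of the line\<close>

text \<open>A cross of \<open>g\<close> at \<open>n\<close> would be open at \<open>n + 1\<close>
  without being a cross of \<open>f\<close>, so \<open>g n = f n\<close> on both sides. If a cap
  ends at \<open>n\<close>, its start leaves the open crosses, but being mixed still demands that
  \<open>f\<close> has a cross there.\<close>

lemma partial_matches_Suc_other:
  assumes n: "f n \<noteq> Cross"
  shows "partial_matches f (n + 1) = partial_matches f n"
proof -
  have gn: "g n = f n" if "g \<in> partial_matches f (n + 1)" for g
  proof -
    have "g n \<noteq> Cross"
      using that n by (auto simp: partial_matches_def open_crosses_Suc crosses_def)
    then show ?thesis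
      using that core_eqD[of g f n] n by (auto simp: partial_matches_def)
  qed
  have agree: "(\<forall>m\<ge>n. g m = f m) \<longleftrightarrow> g n = f n \<and> (\<forall>m\<ge>n + 1. g m = f m)" for g
    by (metis order.order_iff_strict zle_add1_eq_le add1_zle_eq)
  have eq: "closed_below f g (n + 1) \<and> open_crosses g (n + 1) \<subseteq> crosses f \<longleftrightarrow>
      closed_below f g n \<and> open_crosses g n \<subseteq> crosses f" if "g n = f n" for g
  proof -
    have lt: "b < n" if "b \<in> open_crosses g n" for b using that by (simp add: open_crosses_def)
    have lt': "b < n" if "b \<in> open_crosses g (n + 1)" for b
      using that \<open>g n = f n\<close> n by (auto simp: open_crosses_Suc lt)
    have "(\<forall>b. is_cap g b n \<longrightarrow> mixed f b n) \<and> open_crosses g (n + 1) \<subseteq> crosses f \<longleftrightarrow>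
        open_crosses g n \<subseteq> crosses f"
    proof (intro iffI conjI subsetI allI impI; (elim conjE)?)
      fix b assume "\<forall>b. is_cap g b n \<longrightarrow> mixed f b n" "open_crosses g (n + 1) \<subseteq> crosses f"
        "b \<in> open_crosses g n"
      then show "b \<in> crosses f"
        using open_crosses_less_iff[OF lt, of b g] n by (auto simp: mixed_def crosses_def)
    next
      fix b assume "open_crosses g n \<subseteq> crosses f" "is_cap g b n"
      then show "mixed f b n" using \<open>g n = f n\<close> by (auto simp: is_cap_end_iff mixed_def crosses_def)
    next
      fix b assume "open_crosses g n \<subseteq> crosses f" "b \<in> open_crosses g (n + 1)"
      then show "b \<in> crosses f" using open_crosses_less_iff[OF lt', of b g] by blast
    qed
    then show ?thesis using n by (auto simp: closed_below_Suc)
  qed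
  show ?thesis
  proof (intro set_eqI iffI)
    fix g assume "g \<in> partial_matches f (n + 1)"
    then show "g \<in> partial_matches f n"
      using gn[of g] eq[of g] agree[of g] by (simp add: partial_matches_def)
  next
    fix g assume "g \<in> partial_matches f n"
    then show "g \<in> partial_matches f (n + 1)"
      using eq[of g] agree[of g] by (simp add: partial_matches_def)
  qed
qed

text \<open>With a cross of \<open>g\<close> at \<open>n\<close> no cap ends there, and the only
  change is that \<open>n\<close>, a cross of \<open>f\<close>, becomes open.\<close>

lemma partial_matches_Suc_keep:
  assumes n: "f n = Cross"
  shows "{g \<in> partial_matches f (n + 1). g n = Cross} = partial_matches f n"
proof -
  have agree: "(\<forall>m\<ge>n. g m = f m) \<longleftrightarrow> g n = f n \<and> (\<forall>m\<ge>n + 1. g m = f m)" for g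
    by (metis order.order_iff_strict zle_add1_eq_le add1_zle_eq)
  have "closed_below f g (n + 1) \<longleftrightarrow> closed_below f g n" if "g n = Cross" for g
    using that by (auto simp: closed_below_Suc open_crosses_Suc is_cap_def)
  moreover have "open_crosses g (n + 1) \<subseteq> crosses f \<longleftrightarrow> open_crosses g n \<subseteq> crosses f"
    if "g n = Cross" for g
  proof -
    have "open_crosses g (n + 1) = insert n (open_crosses g n)"
      using that by (auto simp: open_crosses_Suc) (auto simp: open_crosses_def nonneg_upto_def)
    then show ?thesis using n by (simp add: crosses_def)
  qed
  ultimately show ?thesis
    using n by (auto simp: partial_matches_def agree)
qed

text \<open>The cross of \<open>f\<close> at \<open>n\<close> must lie on a cap of \<open>g\<close>,
  which can only end there. Its start \<open>s\<close> is the one open cross that is closed at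
  \<open>n\<close>, and mixedness makes \<open>f s\<close> a circle. The condition on
  \<open>s\<close> is phrased as in \<open>move_partial_matches_iff\<close> so that the two can be
  compared.\<close>

lemma partial_matches_Suc_moved_iff:
  assumes n: "f n = Cross" and g: "g \<in> weights" "core g = core f" "\<forall>m\<ge>n + 1. g m = f m" "g n = Circ"
  shows "g \<in> partial_matches f (n + 1) \<longleftrightarrow> closed_below f g n \<and>
    (\<exists>s\<in>open_crosses g n. move_weight g s n = 0 \<and> f s = Circ \<and> open_crosses g n - {s} \<subseteq> crosses f)"
    (is "_ \<longleftrightarrow> ?R")
proof -
  have lt: "b < n" if "b \<in> open_crosses g n" for b using that by (simp add: open_crosses_def)
  have lt': "b < n" if "b \<in> open_crosses g (n + 1)" for b
    using that g(4) by (auto simp: open_crosses_Suc lt)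
  have cap: "is_cap g b n \<longleftrightarrow> b \<in> open_crosses g n \<and> move_weight g b n = 0" for b
    using g(4) by (simp add: is_cap_end_iff)
  have notin: "n \<notin> open_crosses g (n + 1)" using lt' by blast
  have "g \<in> partial_matches f (n + 1) \<longleftrightarrow> closed_below f g n \<and> (\<forall>b. is_cap g b n \<longrightarrow> f b = Circ) \<and>
      (\<exists>b. is_cap g b n) \<and> open_crosses g (n + 1) \<subseteq> crosses f"
    using n g notin by (auto simp: partial_matches_def closed_below_Suc mixed_def)
  also have "\<dots> \<longleftrightarrow> ?R"
  proof
    assume L: "closed_below f g n \<and> (\<forall>b. is_cap g b n \<longrightarrow> f b = Circ) \<and>
      (\<exists>b. is_cap g b n) \<and> open_crosses g (n + 1) \<subseteq> crosses f"
    then obtain s where s: "is_cap g s n" by blast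
    have "b \<in> crosses f" if "b \<in> open_crosses g n - {s}" for b
    proof -
      have "\<not> is_cap g b n"
        using adjacent_unique[of b g n s n] s that lt cap by auto
      then show ?thesis using that L open_crosses_less_iff[OF lt, of b g] by blast
    qed
    then show ?R using L s cap by blast
  next
    assume ?R
    then obtain s where s: "closed_below f g n" "s \<in> open_crosses g n" "move_weight g s n = 0"
      "f s = Circ" "open_crosses g n - {s} \<subseteq> crosses f" by blast
    have "b = s" if "is_cap g b n" for b
      using adjacent_unique[of b g n s n] s that lt cap by auto
    moreover have "s \<notin> open_crosses g (n + 1)"
      using s g(4) lt by (auto simp: open_crosses_Suc)
    then have "open_crosses g (n + 1) \<subseteq> crosses f"
      using s(5) open_crosses_less_iff[OF lt', of _ g] by blast
    ultimately show "closed_below f g n \<and> (\<forall>b. is_cap g b n \<longrightarrow> f b = Circ) \<and>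
      (\<exists>b. is_cap g b n) \<and> open_crosses g (n + 1) \<subseteq> crosses f"
      using s cap by blast
  qed
  finally show ?thesis .
qed

section \<open>Undoing a move\<close>

text \<open>\<open>move g b n\<close> takes the cross at \<open>b\<close> back to \<open>n\<close>,
  reversing a move from \<open>n\<close> to \<open>b\<close>.\<close>

lemma move_weight_move:
  assumes "g b = Cross" "b < n" "c \<le> n"
  shows "move_weight (move g b n) x c = move_weight g x c - (if x < b \<and> b < c then 2 else 0)"
  by (rule move_weight_drop_cross[of g b n]) (use assms in \<open>auto simp: move_def\<close>)

text \<open>Heights across \<open>b\<close> drop by 2. If the height from \<open>x\<close> at
  \<open>b\<close> was 0, the path now falls to -1 just after \<open>b\<close>. If it was at least
  1, the heights beyond \<open>b\<close> were at least 2, because \<open>b\<close> itself is open,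
  and so stay nonnegative.\<close>

lemma open_crosses_move:
  assumes b: "b \<in> open_crosses g n"
  shows "open_crosses (move g b n) n =
    {x \<in> open_crosses g n. x \<noteq> b \<and> \<not> (x < b \<and> move_weight g x b = 0)}"
proof -
  have gb: "g b = Cross" "b < n" "nonneg_upto g b n" using b by (auto simp: open_crosses_def)
  note W = move_weight_move[of g b n, OF gb(1,2)]
  have "x \<in> open_crosses (move g b n) n \<longleftrightarrow>
      x \<in> open_crosses g n \<and> x \<noteq> b \<and> \<not> (x < b \<and> move_weight g x b = 0)" if "x < n" for x
  proof (cases x b rule: linorder_cases)
    case less
    have "nonneg_upto (move g b n) x n \<longleftrightarrow> nonneg_upto g x n \<and> move_weight g x b \<noteq> 0"
    proof
      assume N: "nonneg_upto (move g b n) x n"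
      have "0 \<le> move_weight g x c" if "x < c" "c \<le> n" for c
        using nonneg_uptoD[OF N that] W[OF that(2), of x] by (auto split: if_splits)
      moreover have "1 \<le> move_weight g x b"
        using nonneg_uptoD[OF N, of "b + 1"] W[of "b + 1" x] less gb move_weight_Suc[OF less, of g]
        by auto
      ultimately show "nonneg_upto g x n \<and> move_weight g x b \<noteq> 0"
        by (auto simp: nonneg_upto_def)
    next
      assume N: "nonneg_upto g x n \<and> move_weight g x b \<noteq> 0"
      then have "0 < move_weight g x b"
        using nonneg_uptoD[of g x n b] less gb by auto
      then have "2 \<le> move_weight g x c" if "b < c" "c \<le> n" for c
        using move_weight_split[of x b c g] less that gb nonneg_uptoD[OF gb(3) that] by simp
      then have "0 \<le> move_weight (move g b n) x c" if "x < c" "c \<le> n" for c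
        using W[OF that(2), of x] nonneg_uptoD[of g x n c] N that less by auto
      then show "nonneg_upto (move g b n) x n" by (simp add: nonneg_upto_def)
    qed
    then show ?thesis using less that by (auto simp: open_crosses_def move_def)
  next
    case equal
    then show ?thesis using gb by (simp add: open_crosses_def move_def)
  next
    case greater
    have "nonneg_upto (move g b n) x n \<longleftrightarrow> nonneg_upto g x n"
      unfolding nonneg_upto_def using W[of _ x] greater by auto
    then show ?thesis using greater that by (simp add: open_crosses_def move_def)
  qed
  moreover have "x < n" if "x \<in> open_crosses h n" for x h
    using that by (simp add: open_crosses_def)
  ultimately show ?thesis by blast
qed

text \<open>As \<open>b\<close> is open, no cap of \<open>g\<close> ending before \<open>n\<close>
  begins at \<open>b\<close> or passes over it, so none is destroyed. The only new cap joins the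
  preceding open cross to the new circle at \<open>b\<close>.\<close>

lemma is_cap_move:
  assumes b: "b \<in> open_crosses g n" and y: "y < n"
  shows "is_cap (move g b n) x y \<longleftrightarrow>
    is_cap g x y \<or> y = b \<and> x \<in> open_crosses g n \<and> x < b \<and> move_weight g x b = 0"
proof -
  have gb: "g b = Cross" "b < n" "nonneg_upto g b n" using b by (auto simp: open_crosses_def)
  note W = move_weight_move[of g b n, OF gb(1,2)]
  have val: "move g b n m = (if m = b then Circ else g m)" if "m < n" for m
    using that gb by (simp add: move_def)
  consider "y \<le> x" | "x < y" "b < x \<or> y < b" | "x < y" "x = b" | "x < y" "y = b" | "x < b" "b < y"
    by linarith
  then show ?thesis
  proof cases
    case 1
    then show ?thesis by (auto simp: is_cap_def)
  next
    case 2
    have "move_weight (move g b n) x c = move_weight g x c" if "c \<le> y" for c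
      using W[of c x] that y 2 by auto
    then show ?thesis
      using 2 y val[of x] val[of y] by (auto simp: is_cap_def nonneg_upto_def)
  next
    case 3
    have "\<not> is_cap g b y" using is_cap_not_nonneg_upto[OF _ y] gb by blast
    then show ?thesis using 3 y val[of x] by (auto simp: is_cap_def)
  next
    case 4
    have w: "move_weight (move g b n) x c = move_weight g x c" if "c \<le> y" for c
      using W[of c x] that y 4 by auto
    have "is_cap (move g b n) x y \<longleftrightarrow> g x = Cross \<and> nonneg_upto g x b \<and> move_weight g x b = 0"
      using 4 y w val[of x] val[of y] by (auto simp: is_cap_def nonneg_upto_def)
    also have "\<dots> \<longleftrightarrow> x \<in> open_crosses g n \<and> move_weight g x b = 0"
    proof -
      have "nonneg_upto g x n" if N: "nonneg_upto g x b" "move_weight g x b = 0"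
        unfolding nonneg_upto_def
      proof (intro allI impI)
        fix c assume c: "x < c \<and> c \<le> n"
        show "0 \<le> move_weight g x c"
        proof (cases "c \<le> b")
          case True
          then show ?thesis using N c nonneg_uptoD by blast
        next
          case False
          then show ?thesis
            using N c 4 gb move_weight_split[of x b c g] nonneg_uptoD[OF gb(3), of c] by simp
        qed
      qed
      moreover have "nonneg_upto g x b" if "nonneg_upto g x n"
        using that gb by (auto simp: nonneg_upto_def)
      ultimately show ?thesis using 4 y by (auto simp: open_crosses_def)
    qed
    finally show ?thesis using 4 gb by (auto simp: is_cap_def)
  next
    case 5
    have "1 \<le> move_weight g x y" if "is_cap g x y"
      using that 5 gb y move_weight_split[of x b y g] nonneg_uptoD[of g x y b] nonneg_uptoD[OF gb(3), of y]
      by (simp add: is_cap_def)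
    then have 1: "\<not> is_cap g x y" by (auto simp: is_cap_def)
    \<comment> \<open>A new cap over \<open>b\<close> would have height 2 at \<open>y\<close> in
      \<open>g\<close>, yet the parts before and after \<open>b\<close> contribute at least 1 each
      and the cross at \<open>b\<close> another 1.\<close>
    have False if cap: "is_cap (move g b n) x y"
    proof -
      have "g y = Circ" using cap 5 y by (simp add: is_cap_def val)
      moreover have "0 \<le> move_weight g b (y + 1)"
        using nonneg_uptoD[OF gb(3), of "y + 1"] y 5 by simp
      ultimately have "1 \<le> move_weight g b y" using 5 by (simp add: move_weight_Suc)
      moreover have "0 \<le> move_weight (move g b n) x (b + 1)"
        using cap 5 nonneg_uptoD[of "move g b n" x y "b + 1"] by (simp add: is_cap_def)
      then have "1 \<le> move_weight g x b"
        using W[of "b + 1" x] 5 gb move_weight_Suc[of x b g] by simp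
      moreover have "move_weight g x y = 2"
        using cap W[of y x] 5 y by (simp add: is_cap_def)
      ultimately show False using move_weight_split[of x b y g] 5 gb by simp
    qed
    then show ?thesis using 1 5 by blast
  qed
qed

text \<open>Turning the open cross \<open>b\<close> of \<open>g\<close> into a circle closes the preceding open cross, if there is
  one, with a cap ending at \<open>b\<close>. Every other open cross stays open, so \<open>s\<close>, the only one
  that \<open>f\<close> labels by a circle, is one of these two.\<close>

lemma move_partial_matches_iff:
  assumes b: "b \<in> open_crosses g n" and core: "core g = core f"
  shows "closed_below f (move g b n) n \<and> open_crosses (move g b n) n \<subseteq> crosses f \<longleftrightarrow>
    closed_below f g n \<and> (\<exists>s\<in>open_crosses g n. f s = Circ \<and> open_crosses g n - {s} \<subseteq> crosses f \<and>
      (b = s \<or> s < b \<and> move_weight g s b = 0))" (is "?L \<longleftrightarrow> ?R")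
proof -
  define U G where "U = open_crosses g n" and "G = move g b n"
  \<comment> \<open>\<open>adj\<close> singles out the open cross, if any, that the new circle at
    \<open>b\<close> closes.\<close>
  define adj where "adj x \<longleftrightarrow> x \<in> U \<and> x < b \<and> move_weight g x b = 0" for x
  have gb: "g b = Cross" "b < n" using b by (auto simp: open_crosses_def)
  have bU: "b \<in> U" using b by (simp add: U_def)
  have Gb: "G b = Circ" using gb by (simp add: G_def move_def)
  have UG: "open_crosses G n = {x \<in> U. x \<noteq> b \<and> \<not> adj x}"
    using open_crosses_move[OF b] by (auto simp: U_def G_def adj_def)
  have cap: "is_cap G x y \<longleftrightarrow> is_cap g x y \<or> y = b \<and> adj x" if "y < n" for x y
    using is_cap_move[OF b that] by (simp add: G_def adj_def U_def)
  have adj_unique: "x = y" if "adj x" "adj y" for x y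
    using that adjacent_unique[of x g n y b] gb by (auto simp: adj_def U_def)
  have fb: "f b = Cross \<or> f b = Circ" using core_eqD(1)[OF core, of b] gb by simp
  show ?thesis
  proof
    assume ?L
    then have L: "closed_below f G n" "open_crosses G n \<subseteq> crosses f" by (auto simp: G_def)
    have Lc: "mixed f x y" if "is_cap G x y" "y < n" for x y
      using L(1) that by (auto simp: closed_below_def)
    have Le: "m \<in> open_crosses G n \<or> (\<exists>x y. is_cap G x y \<and> y < n \<and> (m = x \<or> m = y))"
      if "m < n" "f m = Cross" for m
      using L(1) that by (auto simp: closed_below_def)
    have "m \<in> U \<or> (\<exists>x y. is_cap g x y \<and> y < n \<and> (m = x \<or> m = y))" if "m < n" "f m = Cross" for m
      using Le[OF that] cap bU UG unfolding adj_def by blast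
    then have "closed_below f g n"
      using Lc cap unfolding closed_below_def U_def by blast
    \<comment> \<open>If \<open>f\<close> has a circle at \<open>b\<close>, then \<open>s\<close> is
      \<open>b\<close>. If it has a cross there, this cross must lie on the new cap, whose start is
      then a circle of \<open>f\<close> and serves as \<open>s\<close>.\<close>
    moreover have "\<exists>s\<in>U. f s = Circ \<and> U - {s} \<subseteq> crosses f \<and> (b = s \<or> adj s)"
    proof (cases "f b = Cross")
      case True
      have "\<not> is_cap g x b" for x using gb by (simp add: is_cap_def)
      moreover obtain x y where xy: "is_cap G x y" "y < n" "b = x \<or> b = y"
        using Le[OF gb(2) True] UG by blast
      then have "b = y" using Gb by (auto simp: is_cap_def)
      ultimately have x: "adj x" using xy cap by blast
      then have "f x = Circ" using Lc[of x b] cap[of b x] gb True by (auto simp: mixed_def)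
      moreover have "U - {x} \<subseteq> crosses f"
        using adj_unique[OF x] L(2) UG True by (auto simp: crosses_def)
      ultimately show ?thesis using x by (auto simp: adj_def)
    next
      case False
      then have "f b = Circ" using fb by simp
      moreover have "z \<in> crosses f" if "z \<in> U - {b}" for z
      proof (cases "adj z")
        case True
        then show ?thesis
          using Lc[of z b] cap[of b z] gb \<open>f b = Circ\<close> by (auto simp: mixed_def crosses_def)
      qed (use that UG L(2) in blast)
      ultimately show ?thesis using bU by blast
    qed
    ultimately show ?R by (auto simp: U_def adj_def)
  next
    assume ?R
    then obtain s where g: "closed_below f g n" and s: "s \<in> U" "f s = Circ" "U - {s} \<subseteq> crosses f"
      "b = s \<or> adj s" by (auto simp: U_def adj_def)
    have others: "f x = Cross" if "x \<in> U" "x \<noteq> s" for x using that s(3) by (auto simp: crosses_def)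
    have "mixed f x b" if "adj x" for x
      using s(4)
    proof
      assume "b = s"
      then show ?thesis using that s others[of x] by (auto simp: mixed_def adj_def)
    next
      assume "adj s"
      then have "x = s" "b \<noteq> s" using that adj_unique by (auto simp: adj_def)
      then show ?thesis using s others[OF bU] by (simp add: mixed_def)
    qed
    then have "mixed f x y" if "is_cap G x y" "y < n" for x y
      using that cap g by (auto simp: closed_below_def)
    moreover have "m \<in> open_crosses G n \<or> (\<exists>x y. is_cap G x y \<and> y < n \<and> (m = x \<or> m = y))"
      if m: "m < n" "f m = Cross" for m
    proof (cases "m \<in> U")
      case True
      have "adj s" if "m = b" using s that m by auto
      then show ?thesis using True UG cap[of b] gb by blast
    next
      case False
      then show ?thesis using g m cap unfolding closed_below_def U_def by blast
    qed
    ultimately have "closed_below f G n" by (auto simp: closed_below_def)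
    moreover have "open_crosses G n \<subseteq> crosses f" using UG s by blast
    ultimately show ?L by (simp add: G_def)
  qed
qed

section \<open>Cancellation of signs\<close>

text \<open>The left side is the coefficient of \<open>g\<close> in the sum of all moves from
  \<open>n\<close> out of \<open>partial_matches f n\<close>, indexed by their ends
  \<open>b\<close>.\<close>

lemma sum_signs_moved:
  assumes n: "f n = Cross" and g: "g \<in> weights" "core g = core f" "\<forall>m\<ge>n + 1. g m = f m" "g n = Circ"
  shows "(\<Sum>b\<in>{b \<in> open_crosses g n. move g b n \<in> partial_matches f n}.
    (- 1) ^ nat (move_weight g b n)) = (of_bool (g \<in> partial_matches f (n + 1)) :: int)"
    (is "sum ?sign ?B = _")
proof -
  define U where "U = open_crosses g n"
  define hole where "hole s \<longleftrightarrow> s \<in> U \<and> f s = Circ \<and> U - {s} \<subseteq> crosses f" for s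
  have hole_unique: "s = t" if "hole s" "hole t" for s t
    using that by (auto simp: hole_def crosses_def)
  have U: "b < n" "g b = Cross" "nonneg_upto g b n" if "b \<in> U" for b
    using that by (auto simp: U_def open_crosses_def)
  have B_iff: "b \<in> ?B \<longleftrightarrow> b \<in> U \<and> closed_below f g n \<and>
      (\<exists>s. hole s \<and> (b = s \<or> s < b \<and> move_weight g s b = 0))" for b
  proof (cases "b \<in> U")
    case True
    have "move g b n m = f m" if "n \<le> m" for m
      using g n U[OF True] that by (cases "m = n") (auto simp: move_def)
    moreover have "move g b n \<in> weights" "core (move g b n) = core f"
      using g U[OF True] core_move(1)[of g b n] move_in_weights[of g b n] by auto
    ultimately show ?thesis
      using move_partial_matches_iff[of b g n f] True g(2)
      by (auto simp: partial_matches_def U_def hole_def)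
  qed (simp add: U_def)
  have R: "g \<in> partial_matches f (n + 1) \<longleftrightarrow> closed_below f g n \<and> (\<exists>s. hole s \<and> move_weight g s n = 0)"
    using partial_matches_Suc_moved_iff[OF n g] by (auto simp: hole_def U_def)
  show ?thesis
  proof (cases "closed_below f g n \<and> (\<exists>s. hole s)")
    case False
    then have "?B = {}" "g \<notin> partial_matches f (n + 1)" using B_iff R by blast+
    then show ?thesis by (simp only: sum.empty of_bool_eq)
  next
    case True
    then obtain s where cb: "closed_below f g n" and s: "hole s" by blast
    then have sU: "s \<in> U" by (simp add: hole_def)
    have B: "?B = insert s {b \<in> U. s < b \<and> move_weight g s b = 0}"
      using B_iff cb s sU hole_unique by blast
    have R': "g \<in> partial_matches f (n + 1) \<longleftrightarrow> move_weight g s n = 0"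
      using R cb s hole_unique by blast
    \<comment> \<open>The cross at \<open>b\<close> adds 1, so moves ending at \<open>s\<close> and
      at \<open>b\<close> carry opposite signs.\<close>
    have split: "move_weight g s n = 1 + move_weight g b n" "0 \<le> move_weight g b n"
      if "b \<in> U" "s < b" "move_weight g s b = 0" for b
      using that move_weight_split[of s b n g] U[of b] nonneg_uptoD[of g b n n] by auto
    show ?thesis
    proof (cases "move_weight g s n = 0")
      case True
      then have "?B = {s}" using B split by fastforce
      then show ?thesis using True R' by simp
    next
      case False
      moreover have "0 \<le> move_weight g s n" using U[OF sU] nonneg_uptoD[of g s n n] by simp
      ultimately have "0 < move_weight g s n" by simp
      \<comment> \<open>The last return to height 0 is an open cross: the next one after
        \<open>s\<close>.\<close>
      then obtain b where b: "s < b" "b \<in> U" "move_weight g s b = 0"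
        using ex_last_level[of s n 0 g] U[OF sU] by (auto simp: U_def open_crosses_def)
      have "c = b" if "c \<in> U" "s < c" "move_weight g s c = 0" for c
      proof -
        have "\<not> u < v" if "u \<in> U" "v \<in> U" "s < u" "move_weight g s u = 0" "move_weight g s v = 0" for u v
          using that move_weight_split[of s u v g] U[of u] U[of v] nonneg_uptoD[of g u n v] by auto
        then show ?thesis using that b linorder_neqE by metis
      qed
      then have "?B = {s, b}" using B b by blast
      moreover have "nat (move_weight g s n) = Suc (nat (move_weight g b n))"
        using split[OF b(2,1,3)] by simp
      ultimately show ?thesis using R' False b by simp
    qed
  qed
qed

section \<open>From coefficients to the operators\<close>

text \<open>\<open>cross_list\<close> is decreasing and indexed from 0, so exactly the crosses right
  of \<open>n\<close> precede it. This tells which \<open>sigma i\<close> moves the cross at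
  \<open>n\<close>.\<close>

lemma cross_list_nth:
  assumes g: "g \<in> weights" and n: "g n = Cross"
  shows "cross_list g ! card {m. n < m \<and> g m = Cross} = n"
proof -
  define A B where "A = {m. m < n \<and> g m = Cross}" and "B = {m. n < m \<and> g m = Cross}"
  have fin: "finite A" "finite B"
    using finite_crosses[OF g] by (auto simp: A_def B_def crosses_def elim: rev_finite_subset)
  define L where "L = sorted_list_of_set A @ n # sorted_list_of_set B"
  have "crosses g = set L"
    using n fin by (auto simp: L_def A_def B_def crosses_def)
  moreover have "sorted L" "distinct L"
    using fin by (auto simp: L_def A_def B_def sorted_append)
  ultimately have "cross_list g = rev L"
    by (simp only: cross_list_def sorted_list_of_set.idem_if_sorted_distinct)
  then show ?thesis
    using fin by (simp add: L_def nth_append B_def[symmetric])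
qed

lemma sum_frag_cmul: "(\<Sum>b\<in>B. frag_cmul (c b) x) = frag_cmul (\<Sum>b\<in>B. c b) x"
  by (induction B rule: infinite_finite_induct) (simp_all add: frag_cmul_distrib)

text \<open>Heights from \<open>b\<close> up to \<open>n\<close> do not see the symbols at
  \<open>b\<close> and \<open>n\<close>, so legality of the move is openness of \<open>b\<close>
  after it. Moves can thus be indexed by their result.\<close>

lemma legal_move_iff:
  assumes "g' \<in> partial_matches f n" "f n = Cross"
  shows "legal_move g' n b \<and> g = move g' n b \<longleftrightarrow>
    g n = Circ \<and> b \<in> open_crosses g n \<and> g' = move g b n"
proof -
  have g'n: "g' n = Cross" using assms by (auto simp: partial_matches_def)
  have inv: "g = move g' n b \<longleftrightarrow> g' = move g b n"
    if "b < n" "g' b = Circ" "g b = Cross" "g n = Circ"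
    using that g'n by (auto simp: move_def fun_eq_iff)
  have w: "move_weight (move g' n b) b c = move_weight g' b c" if "c \<le> n" for c
    using that by (intro move_weight_cong) (auto simp: move_def)
  have w': "nonneg_upto (move g' n b) b n \<longleftrightarrow> nonneg_upto g' b n"
    by (simp add: nonneg_upto_def w)
  show ?thesis
  proof
    assume L: "legal_move g' n b \<and> g = move g' n b"
    then have "b < n" "g' b = Circ" "nonneg_upto g' b n" "g b = Cross" "g n = Circ"
      by (auto simp: legal_move_def nonneg_upto_def move_def)
    then show "g n = Circ \<and> b \<in> open_crosses g n \<and> g' = move g b n"
      using L inv w' by (auto simp: open_crosses_def)
  next
    assume R: "g n = Circ \<and> b \<in> open_crosses g n \<and> g' = move g b n"
    then have "b < n" "g' b = Circ" "g b = Cross" "g n = Circ" "nonneg_upto g b n"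
      by (auto simp: open_crosses_def move_def)
    then show "legal_move g' n b \<and> g = move g' n b"
      using R inv w' g'n by (auto simp: legal_move_def nonneg_upto_def)
  qed
qed

text \<open>The double sum over diagrams and move ends is regrouped by the resulting diagram, and
  \<open>sum_signs_moved\<close> gives each coefficient. Results have a circle at \<open>n\<close>,
  so they are disjoint from the diagrams contributed by the summand 1.\<close>

lemma sigma_partial_matches:
  assumes n: "f n = Cross" and fin: "finite (partial_matches f n)"
    and i: "i = Suc (card {m. n < m \<and> f m = Cross})"
  defines "x \<equiv> (\<Sum>g\<in>partial_matches f n. frag_of g)"
  shows "finite (partial_matches f (n + 1))"
    and "x + sigma i x = (\<Sum>g\<in>partial_matches f (n + 1). frag_of g)"
proof -
  define Q Q' M where "Q = partial_matches f n" and "Q' = partial_matches f (n + 1)"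
    and "M = {g \<in> partial_matches f (n + 1). g n = Circ}"
  define S where "S = (SIGMA g:Q. {b. legal_move g n b})"
  define mv where "mv p = move (fst p) n (snd p)" for p :: "(int \<Rightarrow> symbol) \<times> int"
  define t where "t p = frag_cmul ((- 1) ^ nat (move_weight (fst p) (snd p) n)) (frag_of (mv p))"
    for p :: "(int \<Rightarrow> symbol) \<times> int"
  have Qw: "g \<in> weights" "core g = core f" "g m = f m" if "g \<in> Q" "n \<le> m" for g m
    using that by (auto simp: Q_def partial_matches_def)
  have S: "finite S"
    unfolding S_def using fin finite_legal_move Qw by (intro finite_SigmaI) (auto simp: Q_def)
  have fibre: "{p \<in> S. mv p = g} = (\<lambda>b. (move g b n, b)) ` {b \<in> open_crosses g n. move g b n \<in> Q}"
    if "g n = Circ" for g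
  proof -
    have *: "(g', b) \<in> S \<and> mv (g', b) = g \<longleftrightarrow> g' \<in> Q \<and> b \<in> open_crosses g n \<and> g' = move g b n" for g' b
      using that legal_move_iff[of g' f n b g, OF _ n] by (auto simp: S_def mv_def Q_def)
    show ?thesis
    proof (rule set_eqI)
      fix p :: "(int \<Rightarrow> symbol) \<times> int"
      obtain g' b where "p = (g', b)" by (cases p)
      then show "p \<in> {p \<in> S. mv p = g} \<longleftrightarrow>
          p \<in> (\<lambda>b. (move g b n, b)) ` {b \<in> open_crosses g n. move g b n \<in> Q}"
        using *[of g' b] by auto
    qed
  qed
  have R: "g \<in> weights" "core g = core f" "\<forall>m\<ge>n + 1. g m = f m" "g n = Circ" if gS: "g \<in> mv ` S" for g
  proof -
    obtain g' b where g': "g' \<in> Q" "legal_move g' n b" "g = move g' n b"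
      using gS by (auto simp: S_def mv_def)
    then show "g \<in> weights" "core g = core f" "g n = Circ" "\<forall>m\<ge>n + 1. g m = f m"
      using Qw[OF g'(1)] move_in_weights[of g' n b] core_move(1)[of g' n b]
      by (auto simp: legal_move_def move_def)
  qed
  have signs: "sum t {p \<in> S. mv p = g} = frag_cmul (of_bool (g \<in> Q')) (frag_of g)" if "g \<in> mv ` S" for g
  proof -
    have "sum t {p \<in> S. mv p = g} =
        (\<Sum>b\<in>{b \<in> open_crosses g n. move g b n \<in> Q}. t (move g b n, b))"
      unfolding fibre[of g, OF R(4)[OF that]] by (subst sum.reindex) (auto simp: inj_on_def)
    also have "\<dots> = (\<Sum>b\<in>{b \<in> open_crosses g n. move g b n \<in> Q}.
        frag_cmul ((- 1) ^ nat (move_weight g b n)) (frag_of g))"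
    proof (rule sum.cong[OF refl])
      fix b assume b: "b \<in> {b \<in> open_crosses g n. move g b n \<in> Q}"
      then have "mv (move g b n, b) = g"
        using R(4)[OF that] by (auto simp: mv_def move_def open_crosses_def)
      moreover have "move_weight (move g b n) b n = move_weight g b n"
        by (intro move_weight_cong) (auto simp: move_def)
      ultimately show "t (move g b n, b) = frag_cmul ((- 1) ^ nat (move_weight g b n)) (frag_of g)"
        by (simp add: t_def)
    qed
    finally show ?thesis
      using sum_signs_moved[OF n R[OF that]] by (simp add: sum_frag_cmul Q_def Q'_def)
  qed
  \<comment> \<open>A diagram in \<open>M\<close> has coefficient 1, so its sum is not empty and
    some move leads to it. This also bounds \<open>M\<close> by a finite set.\<close>
  have M_sub: "M \<subseteq> mv ` S"
  proof
    fix g assume g: "g \<in> M"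
    then have g': "g \<in> weights" "core g = core f" "\<forall>m\<ge>n + 1. g m = f m" "g n = Circ"
      and "g \<in> partial_matches f (n + 1)" by (auto simp: M_def partial_matches_def)
    then have "{b \<in> open_crosses g n. move g b n \<in> Q} \<noteq> {}"
      using sum_signs_moved[OF n g'] by (auto simp: Q_def simp del: Collect_empty_eq)
    then have "{p \<in> S. mv p = g} \<noteq> {}"
      unfolding fibre[of g, OF g'(4)] by (simp only: image_is_empty simp_thms)
    then show "g \<in> mv ` S" by blast
  qed
  then have M: "finite M" "M = {g \<in> mv ` S. g \<in> Q'}"
    using S R by (auto simp: M_def Q'_def intro: finite_subset)
  have Q'_split: "Q' = Q \<union> M" "Q \<inter> M = {}"
  proof -
    have "g n = Cross \<or> g n = Circ" if "g \<in> Q'" for g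
      using that core_eqD(1)[of g f n] n by (auto simp: Q'_def partial_matches_def)
    moreover have keep: "{g \<in> Q'. g n = Cross} = Q"
      using partial_matches_Suc_keep[of f n, OF n] by (simp add: Q_def Q'_def)
    ultimately show "Q' = Q \<union> M" by (auto simp: M_def Q'_def[symmetric])
    show "Q \<inter> M = {}" unfolding keep[symmetric] M_def by auto
  qed
  have "finite Q" using fin by (simp add: Q_def)
  then have "finite Q'" unfolding Q'_split(1) using M(1) by simp
  then show "finite (partial_matches f (n + 1))" by (simp add: Q'_def)
  have "sigma i (frag_of g) = (\<Sum>b | legal_move g n b. t (g, b))" if "g \<in> Q" for g
  proof -
    \<comment> \<open>All diagrams in \<open>Q\<close> agree with \<open>f\<close> from
      \<open>n\<close> on, so \<open>n\<close> is the \<open>i\<close>-th cross of each of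
      them.\<close>
    have "{m. n < m \<and> f m = Cross} = {m. n < m \<and> g m = Cross}" using Qw(3)[OF that] by auto
    then have "cross_list g ! (i - 1) = n"
      using cross_list_nth[of g n] Qw[OF that, of n] n i by simp
    then show ?thesis by (simp add: sigma_def t_def mv_def Let_def)
  qed
  then have "sigma i x = (\<Sum>g\<in>Q. \<Sum>b | legal_move g n b. t (g, b))"
    using fin by (simp add: x_def Q_def sigma_def frag_extend_sum)
  also have "\<dots> = sum t S"
    unfolding S_def using fin finite_legal_move Qw by (subst sum.Sigma) (auto simp: Q_def)
  also have "\<dots> = (\<Sum>g\<in>mv ` S. sum t {p \<in> S. mv p = g})"
    by (rule sum.image_gen[OF S])
  also have "\<dots> = (\<Sum>g\<in>mv ` S. if g \<in> Q' then frag_of g else 0)"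
    by (intro sum.cong refl) (simp add: signs)
  also have "\<dots> = (\<Sum>g\<in>M. frag_of g)"
    unfolding M(2) using S by (intro sum.inter_filter[symmetric]) simp
  finally show "x + sigma i x = (\<Sum>g\<in>partial_matches f (n + 1). frag_of g)"
    using sum.union_disjoint[OF \<open>finite Q\<close> M(1) Q'_split(2), of frag_of] Q'_split(1)
    by (simp add: x_def flip: Q_def Q'_def)
qed

section \<open>The two ends of the scan\<close>

text \<open>A cross of \<open>g\<close> left of \<open>lo\<close> is open or begins a mixed cap
  ending before \<open>lo\<close>; either way \<open>f\<close> would have a cross left of
  \<open>lo\<close>.\<close>

lemma partial_matches_initial:
  assumes f: "f \<in> weights" and lo: "\<And>m. m < lo \<Longrightarrow> f m = Circ"
  shows "partial_matches f lo = {f}"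
proof (intro set_eqI iffI)
  fix g assume "g \<in> partial_matches f lo"
  then have g: "g \<in> weights" "core g = core f" "\<forall>m\<ge>lo. g m = f m" "closed_below f g lo"
    "open_crosses g lo \<subseteq> crosses f" by (auto simp: partial_matches_def)
  have "g m \<noteq> Cross" if m: "m < lo" for m
  proof
    assume "g m = Cross"
    then consider "m \<in> open_crosses g lo" | a where "a < lo" "is_cap g m a"
      using cross_cases[OF g(1) _ m] by blast
    then show False
      using g(4,5) lo m by cases (auto simp: crosses_def closed_below_def mixed_def)
  qed
  then have "g m = f m" for m
    using core_eqD(1)[OF g(2), of m] lo[of m] g(3) by (cases "m < lo") auto
  then show "g \<in> {f}" by auto
next
  have "closed_below f f lo" "open_crosses f lo = {}"
    using lo by (auto simp: closed_below_def open_crosses_def is_cap_def)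
  then show "g \<in> partial_matches f lo" if "g \<in> {f}" for g
    using that f by (simp add: partial_matches_def)
qed

text \<open>From \<open>hi\<close> on \<open>f\<close> has only circles. Hence a cap ending there is
  mixed exactly if its start is a cross of \<open>f\<close>, and in a matching diagram no cap begins
  there.\<close>

lemma partial_matches_final:
  assumes f: "f \<in> weights" and hi: "\<And>m. hi \<le> m \<Longrightarrow> f m = Circ"
  shows "partial_matches f hi = P_set f"
proof (intro set_eqI iffI)
  fix g assume "g \<in> partial_matches f hi"
  then have g: "g \<in> weights" "core g = core f" "\<forall>m\<ge>hi. g m = Circ" "closed_below f g hi"
    "open_crosses g hi \<subseteq> crosses f" using hi by (auto simp: partial_matches_def)
  have "mixed f b a" if cap: "is_cap g b a" for b a
  proof (cases "a < hi")
    case True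
    then show ?thesis using g(4) cap by (simp add: closed_below_def)
  next
    case False
    moreover have "b < hi" using cap g(3) by (metis is_cap_def linorder_not_less symbol.distinct(1))
    ultimately show ?thesis
      using is_cap_open_cross[OF cap, of hi] g(5) hi[of a] by (auto simp: mixed_def crosses_def)
  qed
  moreover have "\<exists>b a. is_cap g b a \<and> (m = b \<or> m = a)" if m: "f m = Cross" for m
  proof -
    have "m < hi" using hi[of m] m by fastforce
    then consider "m \<in> open_crosses g hi" | "\<exists>b a. is_cap g b a \<and> (m = b \<or> m = a)"
      using g(4) m unfolding closed_below_def by blast
    then show ?thesis
    proof cases
      case 1
      then show ?thesis using ex_is_cap[OF g(1), of m] by (auto simp: open_crosses_def)
    qed
  qed
  ultimately show "g \<in> P_set f" using g(1,2) matches_iff[OF f g(1)] by (simp add: P_set_def)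
next
  fix g assume "g \<in> P_set f"
  then have g: "g \<in> weights" and "matches g f" by (auto simp: P_set_def)
  then have co: "core g = core f" and mx: "\<And>b a. is_cap g b a \<Longrightarrow> mixed f b a"
    and ends: "\<And>m. f m = Cross \<Longrightarrow> \<exists>b a. is_cap g b a \<and> (m = b \<or> m = a)"
    using matches_iff[OF f g] by auto
  have no_cross: "g m \<noteq> Cross" if "hi \<le> m" for m
  proof
    assume "g m = Cross"
    then obtain a where "is_cap g m a" using ex_is_cap[OF g] by blast
    then show False using mx[of m a] hi[of m] hi[of a] that by (auto simp: mixed_def is_cap_def)
  qed
  then have "g m = f m" if "hi \<le> m" for m
    using core_eqD(1)[OF co, of m] hi[of m] that by auto
  moreover have "open_crosses g hi \<subseteq> crosses f"
  proof
    fix b assume b: "b \<in> open_crosses g hi"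
    then obtain a where a: "is_cap g b a" using ex_is_cap[OF g] by (auto simp: open_crosses_def)
    have "hi \<le> a" using is_cap_not_nonneg_upto[OF a, of hi] b by (force simp: open_crosses_def)
    then show "b \<in> crosses f" using mx[OF a] hi[of a] by (auto simp: mixed_def crosses_def)
  qed
  moreover have "m \<in> open_crosses g hi \<or> (\<exists>b a. is_cap g b a \<and> a < hi \<and> (m = b \<or> m = a))"
    if m: "m < hi" "f m = Cross" for m
  proof -
    obtain b a where ba: "is_cap g b a" "m = b \<or> m = a" using ends m(2) by blast
    show ?thesis
    proof (cases "a < hi")
      case False
      then have "m = b" using ba m by auto
      then show ?thesis using is_cap_open_cross[OF ba(1), of hi] m False by simp
    qed (use ba in blast)
  qed
  ultimately show "g \<in> partial_matches f hi"
    using g co mx by (simp add: partial_matches_def closed_below_def)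
qed

theorem theoremA:
  fixes f :: "int \<Rightarrow> symbol" and k :: nat
  assumes "f \<in> weights" and "num_crosses f = k"
  shows "foldr (\<lambda>i x. x + sigma i x) [1..<Suc k] (frag_of f) = (\<Sum>g\<in>P_set f. frag_of g)"
proof -
  note f = assms(1)
  \<comment> \<open>Inserting 0 keeps \<open>S\<close> nonempty, so that \<open>Min\<close> and
    \<open>Max\<close> are meaningful.\<close>
  define S where "S = insert 0 {m. f m \<noteq> Circ}"
  have S: "finite S" using f by (simp add: S_def weights_def)
  define lo hi where "lo = Min S" and "hi = Max S + 1"
  have lo: "f m = Circ" if "m < lo" for m
    using Min_le[OF S, of m] that by (force simp: lo_def S_def)
  have hi: "f m = Circ" if "hi \<le> m" for m
    using Max_ge[OF S, of m] that by (force simp: hi_def S_def)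
  have "lo \<le> hi" using Min_le[OF S, of 0] Max_ge[OF S, of 0] by (simp add: lo_def hi_def S_def)
  define above where "above n = card {m. n \<le> m \<and> f m = Cross}" for n
  have fin: "finite {m. P m \<and> f m = Cross}" for P
    using finite_crosses[OF f] by (auto simp: crosses_def elim: rev_finite_subset)
  \<comment> \<open>The crosses of \<open>f\<close> left of \<open>n\<close> are those numbered from
    \<open>Suc (above n)\<close> to \<open>k\<close>. As \<open>foldr\<close> applies the last
    operator first, their operators are the ones already applied.\<close>
  have "finite (partial_matches f n) \<and>
      foldr (\<lambda>i x. x + sigma i x) [Suc (above n)..<Suc k] (frag_of f) =
        (\<Sum>g\<in>partial_matches f n. frag_of g)" if "lo \<le> n" for n
    using that
  proof (induction n rule: int_ge_induct)
    case base
    have "{m. lo \<le> m \<and> f m = Cross} = crosses f"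
      unfolding crosses_def by (rule Collect_cong) (use lo in \<open>force simp: not_less[symmetric]\<close>)
    then have "above lo = k" using assms(2) by (simp add: above_def num_crosses_def)
    then show ?case by (simp add: partial_matches_initial[OF f lo])
  next
    case (step n)
    show ?case
    proof (cases "f n = Cross")
      case True
      have "{m. n \<le> m \<and> f m = Cross} = insert n {m. n + 1 \<le> m \<and> f m = Cross}"
        using True by auto
      then have ab: "above n = Suc (above (n + 1))"
        using fin[of "\<lambda>m. n + 1 \<le> m"] by (simp add: above_def)
      have "above n \<le> k"
        using assms(2) card_mono[OF finite_crosses[OF f], of "{m. n \<le> m \<and> f m = Cross}"]
        by (auto simp: above_def num_crosses_def crosses_def)
      then have "[Suc (above (n + 1))..<Suc k] = Suc (above (n + 1)) # [Suc (above n)..<Suc k]"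
        using ab by (simp add: upt_conv_Cons)
      moreover have "above (n + 1) = card {m. n < m \<and> f m = Cross}"
        by (simp add: above_def add1_zle_eq)
      ultimately show ?thesis
        using sigma_partial_matches[of f n "Suc (above (n + 1))"] True step.IH by simp
    next
      case False
      have "{m. n \<le> m \<and> f m = Cross} = {m. n + 1 \<le> m \<and> f m = Cross}"
        using False by (auto simp: order.order_iff_strict)
      then show ?thesis
        using step.IH partial_matches_Suc_other[of f n] False by (simp add: above_def)
    qed
  qed
  from this[OF \<open>lo \<le> hi\<close>] have "foldr (\<lambda>i x. x + sigma i x) [Suc (above hi)..<Suc k] (frag_of f) =
      (\<Sum>g\<in>P_set f. frag_of g)"
    by (simp add: partial_matches_final[OF f hi])
  moreover have "{m. hi \<le> m \<and> f m = Cross} = {}" using hi by auto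
  then have "above hi = 0" by (simp only: above_def card.empty)
  ultimately show ?thesis by simp
qed

end
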